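(* Let $n=2m$ be an even positive integer greater than $2$, let $V$ be a vector space of dimension $n$ over $\mathbb{F}_q$, and let $\mathcal{M}$ be an $\mathbb{F}_q$-subspace of $\mathrm{Alt}(V)$. Suppose that $\mathrm{rank} f\geq n-2$ for all non-zero elements $f$ of $\mathcal{M}$. Then $\dim\mathcal{M}\leq 3m$.
   Context: $q$ is a power of a prime and $\mathbb{F}_q$ is the field of order $q$. $\mathrm{Alt}(V)$ denotes the $\mathbb{F}_q$-vector space of all alternating bilinear forms $f:V\times V\to\mathbb{F}_q$ (that is, $f(u,u)=0$ for all $u\in V$). The radical of $f$ is $\mathrm{rad} f=\{u\in V: f(u,v)=0\text{ for all }v\in V\}$ and $\mathrm{rank} f=\dim V-\dim\mathrm{rad} f$. *)

theory Defs
  imports Complex_Main "HOL-Library.Function_Algebras"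
begin

text \<open>
  Vector spaces are given by a scalar multiplication \<open>s\<close> on an additive group type, as in the
  locale \<^locale>\<open>vector_space\<close>; the space itself is the whole type. Addition of forms is the
  pointwise one of \<^theory>\<open>HOL-Library.Function_Algebras\<close>.
\<close>

definition form_scale :: "'k::field \<Rightarrow> ('v \<Rightarrow> 'v \<Rightarrow> 'k) \<Rightarrow> 'v \<Rightarrow> 'v \<Rightarrow> 'k" where
  "form_scale c f = (\<lambda>u v. c * f u v)"

interpretation forms: vector_space form_scale
  by unfold_locales (auto simp: form_scale_def fun_eq_iff algebra_simps)

definition bilinear_form ::
    "('k::field \<Rightarrow> 'v::ab_group_add \<Rightarrow> 'v) \<Rightarrow> ('v \<Rightarrow> 'v \<Rightarrow> 'k) \<Rightarrow> bool" where
  "bilinear_form s f \<longleftrightarrow>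
     (\<forall>u. Vector_Spaces.linear s (*) (\<lambda>v. f u v)) \<and>
     (\<forall>v. Vector_Spaces.linear s (*) (\<lambda>u. f u v))"

definition Alt :: "('k::field \<Rightarrow> 'v::ab_group_add \<Rightarrow> 'v) \<Rightarrow> ('v \<Rightarrow> 'v \<Rightarrow> 'k) set" where
  "Alt s = {f. bilinear_form s f \<and> (\<forall>u. f u u = 0)}"

definition form_rad :: "('v \<Rightarrow> 'v \<Rightarrow> 'k::field) \<Rightarrow> 'v set" where
  "form_rad f = {u. \<forall>v. f u v = 0}"

definition form_rank ::
    "('k::field \<Rightarrow> 'v::ab_group_add \<Rightarrow> 'v) \<Rightarrow> ('v \<Rightarrow> 'v \<Rightarrow> 'k) \<Rightarrow> nat" where
  "form_rank s f = vector_space.dim s (UNIV :: 'v set) - vector_space.dim s (form_rad f)"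

lemma subspace_Alt:
  assumes "vector_space s"
  shows "forms.subspace (Alt s)"
proof -
  interpret vector_space s by fact
  have vk: "vector_space ((*) :: 'a \<Rightarrow> 'a \<Rightarrow> 'a)"
    by unfold_locales (auto simp: algebra_simps)
  have lin: "Vector_Spaces.linear s (*) g \<longleftrightarrow>
      (\<forall>x y. g (x + y) = g x + g y) \<and> (\<forall>c x. g (s c x) = c * g x)" for g :: "'b \<Rightarrow> 'a"
    using vk vector_space_axioms
    by (auto simp: Vector_Spaces.linear_iff_module_hom module_hom_iff
        module_iff_vector_space)
  show ?thesis
    by (rule forms.subspaceI)
      (auto simp: Alt_def bilinear_form_def lin form_scale_def algebra_simps)
qed

end

theory Submission
  imports Defs "HOL-Computational_Algebra.Primes" "HOL-Library.FuncSet" "HOL-Library.Multiset"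
    "HOL-Library.Cardinality"
begin

text \<open>
  Let \<open>q = p\<^sup>k\<close> with \<open>p\<close> prime, and suppose that \<open>dim M\<close> is at least \<open>3m + 1\<close>. Count the pairs \<open>(f, u)\<close>
  with \<open>f\<close> in \<open>M\<close> and \<open>u\<close> in the radical of \<open>f\<close> modulo \<open>q\<^sup>3\<close>. For \<open>u \<noteq> 0\<close> the forms in \<open>M\<close> with \<open>u\<close>
  in the radical are a subspace of codimension at most \<open>n - 1\<close> (\<open>card_forms_le\<close>), hence of dimension
  at least \<open>m + 2\<close>, and so their number is divisible by \<open>q\<^sup>3\<close>. On the other hand the rank is even, so
  every degenerate nonzero form in \<open>M\<close> has a radical of size \<open>q\<^sup>2\<close> (\<open>pfaffian_eq_0_iff\<close>). If \<open>z\<close> is the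
  number of degenerate forms in \<open>M\<close>, including \<open>0\<close>, then the two counts give
  \<open>z (q\<^sup>2 - 1) \<equiv> q\<^sup>2\<close> modulo \<open>q\<^sup>3\<close>. Hence \<open>p\<^sup>2\<^sup>k\<^sup>+\<^sup>1\<close> does not divide \<open>z\<close>.

  But the degenerate forms are the zeros of the Pfaffian, a polynomial of degree \<open>m\<close> in more than
  \<open>3m\<close> variables, and by the theorem of Ax their number is divisible by \<open>q\<^sup>3\<close>. Divisibility by
  \<open>p\<^sup>2\<^sup>k\<^sup>+\<^sup>1\<close> is enough for the contradiction, and this weaker fact follows by viewing the equation as \<open>k\<close>
  equations of degree \<open>m\<close> over the prime field in \<open>k dim M\<close> variables (\<open>card_zeros_dvd\<close>).

  Over the prime field there is an elementary argument. Coordinates are lifted to functions with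
  values in \<open>\<nat>\<close>, whose degree is measured by iterated differences. The indicator function of the
  multiples of \<open>p\<close> has a Newton expansion \<open>\<Sum>j. c\<^sub>j (y choose j)\<close> in which \<open>c\<^sub>j\<close> is divisible by about
  \<open>p\<close> to the power \<open>j / (p - 1)\<close> (Fleck's congruence, \<open>dvd_coeff_dvd\<close>). After substituting the lifts,
  the terms with small \<open>j\<close> have small degree, and sums of such functions over a box of side \<open>p\<close> are
  highly divisible by \<open>p\<close> (\<open>boxsum_dvd\<close>). Balancing both effects
  (\<open>boxsum_common_multiples_dvd\<close>) yields the claim.
\<close>

section \<open>Degree by differences and sums over boxes\<close>

definition fdiff :: "'a::comm_monoid_add \<Rightarrow> ('a \<Rightarrow> int) \<Rightarrow> 'a \<Rightarrow> int" where
  "fdiff a H = (\<lambda>x. H (x + a) - H x)"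

text \<open>
  Degree in the sense of Frechet: for functions on \<open>\<nat>\<^sup>d\<close> these are exactly the integer-valued
  polynomial functions of total degree below \<open>s\<close>. Measuring degree by iterated differences keeps
  monomials and coefficients out of all later arguments.
\<close>

primrec deg_less :: "nat \<Rightarrow> ('a::comm_monoid_add \<Rightarrow> int) \<Rightarrow> bool" where
  "deg_less 0 H \<longleftrightarrow> (\<forall>x. H x = 0)"
| "deg_less (Suc s) H \<longleftrightarrow> (\<forall>a. deg_less s (fdiff a H))"

lemma deg_less_zero: "deg_less s (\<lambda>x. 0)"
  by (induction s) (auto simp: fdiff_def)

lemma deg_less_add:
  assumes "deg_less s G" "deg_less s H"
  shows "deg_less s (\<lambda>x. G x + H x)"
  using assms
proof (induction s arbitrary: G H)
  case (Suc s)
  have "fdiff a (\<lambda>x. G x + H x) = (\<lambda>x. fdiff a G x + fdiff a H x)" for a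
    by (auto simp: fdiff_def)
  with Suc show ?case by simp
qed simp

lemma deg_less_cmult:
  assumes "deg_less s H"
  shows "deg_less s (\<lambda>x. c * H x)"
  using assms
proof (induction s arbitrary: H)
  case (Suc s)
  have "fdiff a (\<lambda>x. c * H x) = (\<lambda>x. c * fdiff a H x)" for a
    by (auto simp: fdiff_def algebra_simps)
  with Suc show ?case by simp
qed simp

lemma deg_less_cmult_cancel:
  assumes "deg_less s (\<lambda>x. c * H x)" "c \<noteq> 0"
  shows "deg_less s H"
  using assms
proof (induction s arbitrary: H)
  case (Suc s)
  have "fdiff a (\<lambda>x. c * H x) = (\<lambda>x. c * fdiff a H x)" for a
    by (auto simp: fdiff_def algebra_simps)
  with Suc show ?case by simp
qed simp

lemma deg_less_sum:
  assumes "\<And>i. i \<in> I \<Longrightarrow> deg_less s (G i)"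
  shows "deg_less s (\<lambda>x. \<Sum>i\<in>I. G i x)"
  using assms
  by (induction I rule: infinite_finite_induct) (auto intro: deg_less_add deg_less_zero)

lemma deg_less_shift:
  assumes "deg_less s H"
  shows "deg_less s (\<lambda>x. H (x + a))"
  using assms
proof (induction s arbitrary: H)
  case (Suc s)
  have "fdiff b (\<lambda>x. H (x + a)) = (\<lambda>x. fdiff b H (x + a))" for b
    by (auto simp: fdiff_def ac_simps)
  with Suc show ?case by simp
qed simp

lemma deg_less_Suc: "deg_less s H \<Longrightarrow> deg_less (Suc s) H"
proof (induction s arbitrary: H)
  case 0
  then show ?case by (simp add: fdiff_def)
next
  case (Suc s)
  then show ?case by (metis deg_less.simps(2))
qed

lemma deg_less_mono:
  assumes "deg_less s H" "s \<le> t"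
  shows "deg_less t H"
  using assms(2,1) by (induction rule: dec_induct) (auto dest: deg_less_Suc simp del: deg_less.simps)

lemma deg_less_const: "s \<ge> 1 \<Longrightarrow> deg_less s (\<lambda>x. c)"
  by (rule deg_less_mono[of 1]) (auto simp: fdiff_def)

lemma deg_less_fdiff_funpow:
  assumes "deg_less s H"
  shows "deg_less (s - i) ((fdiff a ^^ i) H)"
proof (induction i)
  case (Suc i)
  show ?case
  proof (cases "s - i")
    case 0
    with Suc show ?thesis by (simp add: fdiff_def)
  next
    case (Suc t)
    with Suc.IH have "deg_less (Suc t) ((fdiff a ^^ i) H)" by simp
    with Suc show ?thesis by (simp add: Suc_diff_Suc diff_Suc)
  qed
qed (use assms in simp)

text \<open>
  Leibniz rule: a difference of \<open>G * H\<close> is a sum of two products, in each of which one factor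
  has been differenced once. The hypothesis \<open>s + t \<le> Suc r\<close> says that degrees add up, since
  \<open>deg_less (Suc d)\<close> stands for degree at most \<open>d\<close>.
\<close>

lemma deg_less_mult:
  assumes "deg_less s G" "deg_less t H" "s + t \<le> Suc r"
  shows "deg_less r (\<lambda>x. G x * H x)"
  using assms
proof (induction r arbitrary: s t G H)
  case 0
  then have "s = 0 \<or> t = 0" by auto
  with 0 show ?case by auto
next
  case (Suc r)
  show ?case
  proof (cases "s = 0 \<or> t = 0")
    case True
    with Suc.prems have "(\<lambda>x. G x * H x) = (\<lambda>x. 0)" by auto
    then show ?thesis by (simp only: deg_less_zero)
  next
    case False
    then obtain a b where st: "s = Suc a" "t = Suc b"
      by (metis not0_implies_Suc)
    have "deg_less r (fdiff c (\<lambda>x. G x * H x))" for c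
    proof -
      have "fdiff c (\<lambda>x. G x * H x) = (\<lambda>x. fdiff c G x * H (x + c) + G x * fdiff c H x)"
        by (auto simp: fdiff_def algebra_simps)
      moreover have "deg_less r (\<lambda>x. fdiff c G x * H (x + c))"
        using Suc.prems st by (intro Suc.IH[of a _ t]) (auto intro: deg_less_shift simp del: deg_less.simps simp: deg_less.simps(2)[of a])
      moreover have "deg_less r (\<lambda>x. G x * fdiff c H x)"
        using Suc.prems st by (intro Suc.IH[of s _ b]) (auto simp del: deg_less.simps simp: deg_less.simps(2)[of b])
      ultimately show ?thesis by (simp only: deg_less_add)
    qed
    then show ?thesis by simp
  qed
qed

lemma deg_less_prod:
  assumes "\<And>i. i \<in> I \<Longrightarrow> deg_less (Suc (d i)) (G i)"
  shows "deg_less (Suc (\<Sum>i\<in>I. d i)) (\<lambda>x. \<Prod>i\<in>I. G i x)"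
  using assms
proof (induction I rule: infinite_finite_induct)
  case (insert i I)
  then have "deg_less (Suc (d i + (\<Sum>i\<in>I. d i))) (\<lambda>x. G i x * (\<Prod>i\<in>I. G i x))"
    by (intro deg_less_mult[of "Suc (d i)" _ "Suc (sum d I)"]) (auto simp del: deg_less.simps)
  with insert show ?case by (simp del: deg_less.simps)
qed (auto intro: deg_less_const simp del: deg_less.simps)

text \<open>
  A binomial coefficient \<open>F choose j\<close> has degree \<open>m * j\<close> because \<open>j!\<close> times it is a product of \<open>j\<close>
  factors \<open>F - i\<close>, and vanishing of differences may be tested after multiplying by \<open>j!\<close>.
\<close>

lemma deg_less_binomial:
  assumes "deg_less (Suc m) (\<lambda>x. int (F x))"
  shows "deg_less (Suc (m * j)) (\<lambda>x. int (F x choose j))"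
proof (induction j)
  case 0
  show ?case by (auto intro: deg_less_const simp del: deg_less.simps)
next
  case (Suc j)
  have "deg_less (Suc m) (\<lambda>x. int (F x) + - int j)"
    using assms by (intro deg_less_add deg_less_const) auto
  with Suc have "deg_less (Suc (m * Suc j)) (\<lambda>x. int (F x choose j) * (int (F x) + - int j))"
    by (intro deg_less_mult) (auto simp del: deg_less.simps)
  also have "(\<lambda>x. int (F x choose j) * (int (F x) + - int j)) = (\<lambda>x. int (Suc j) * int (F x choose Suc j))"
  proof
    fix x
    let ?n = "F x"
    show "int (?n choose j) * (int ?n + - int j) = int (Suc j) * int (?n choose Suc j)"
    proof (cases "j \<le> ?n")
      case True
      have "Suc j * (?n choose Suc j) = (?n - j) * (?n choose j)"
        by (metis binomial_absorb_comp binomial_absorption)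
      then have "int (Suc j) * int (?n choose Suc j) = int (?n - j) * int (?n choose j)"
        by (metis of_nat_mult)
      also have "int (?n - j) = int ?n + - int j"
        using True by (simp add: of_nat_diff)
      finally show ?thesis by (simp only: mult.commute)
    qed (simp add: binomial_eq_0)
  qed
  finally show ?case
    by (rule deg_less_cmult_cancel) simp
qed

lemma newton_forward:
  fixes x e :: "'a::comm_semiring_1"
  shows "H (x + of_nat c * e) = (\<Sum>i\<le>c. int (c choose i) * (fdiff e ^^ i) H x)"
proof (induction c arbitrary: H)
  case (Suc c)
  have "H (x + of_nat (Suc c) * e) = H (x + of_nat c * e) + fdiff e H (x + of_nat c * e)"
    by (simp add: fdiff_def algebra_simps)
  also have "\<dots> = (\<Sum>i\<le>c. int (c choose i) * (fdiff e ^^ i) H x)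
      + (\<Sum>i\<le>c. int (c choose i) * (fdiff e ^^ Suc i) H x)"
    by (simp add: Suc funpow_swap1)
  also have "(\<Sum>i\<le>c. int (c choose i) * (fdiff e ^^ i) H x)
      = (\<Sum>i\<le>Suc c. int (c choose i) * (fdiff e ^^ i) H x)"
    by simp
  also have "\<dots> = H x + (\<Sum>i\<le>c. int (c choose Suc i) * (fdiff e ^^ Suc i) H x)"
    by (subst sum.atMost_Suc_shift) simp
  also have "H x + (\<Sum>i\<le>c. int (c choose Suc i) * (fdiff e ^^ Suc i) H x)
      + (\<Sum>i\<le>c. int (c choose i) * (fdiff e ^^ Suc i) H x)
      = H x + (\<Sum>i\<le>c. int (Suc c choose Suc i) * (fdiff e ^^ Suc i) H x)"
    by (simp add: sum.distrib algebra_simps)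
  also have "\<dots> = (\<Sum>i\<le>Suc c. int (Suc c choose i) * (fdiff e ^^ i) H x)"
    by (subst sum.atMost_Suc_shift) simp
  finally show ?case .
qed simp

text \<open>
  The sum of \<open>H\<close> over the points \<open>x + c\<^sub>1 e\<^sub>1 + \<dots> + c\<^sub>N e\<^sub>N\<close> with all \<open>c\<^sub>i\<close> in \<open>{0..<p}\<close>, each
  choice of the \<open>c\<^sub>i\<close> being counted separately. The recursion allows induction on the number of
  directions.
\<close>

primrec boxsum :: "nat \<Rightarrow> 'a::comm_semiring_1 list \<Rightarrow> ('a \<Rightarrow> int) \<Rightarrow> 'a \<Rightarrow> int" where
  "boxsum p [] H x = H x"
| "boxsum p (e # es) H x = (\<Sum>c<p. boxsum p es H (x + of_nat c * e))"

lemma boxsum_add: "boxsum p es (\<lambda>x. G x + H x) x = boxsum p es G x + boxsum p es H x"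
  by (induction es arbitrary: x) (auto simp: sum.distrib)

lemma boxsum_cmult: "boxsum p es (\<lambda>x. c * H x) x = c * boxsum p es H x"
  by (induction es arbitrary: x) (auto simp: sum_distrib_left)

lemma boxsum_zero: "boxsum p es (\<lambda>x. 0) x = 0"
  by (induction es arbitrary: x) auto

lemma boxsum_sum: "boxsum p es (\<lambda>x. \<Sum>i\<in>I. G i x) x = (\<Sum>i\<in>I. boxsum p es (G i) x)"
  by (induction I rule: infinite_finite_induct) (auto simp: boxsum_zero boxsum_add)

lemma boxsum_shift: "boxsum p es (\<lambda>x. H (x + a)) x = boxsum p es H (x + a)"
  by (induction es arbitrary: x) (auto simp: ac_simps)

lemma boxsum_cong_dvd:
  assumes "\<And>x. q dvd G x - H x"
  shows "q dvd boxsum p es G x - boxsum p es H x"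
  using assms by (induction es arbitrary: x) (auto simp: sum_subtractf[symmetric] intro!: dvd_sum)

text \<open>
  Summing over one direction is the operator \<open>\<Sum>i<p. (p choose Suc i) \<Delta>\<^sup>i\<close>, where all coefficients
  but the last are divisible by \<open>p\<close>. So a direction either lowers the degree by \<open>p - 1\<close> or
  contributes a factor \<open>p\<close>.
\<close>

lemma boxsum_Cons_fdiff:
  fixes x :: "'a::comm_semiring_1"
  assumes "prime p"
  shows "boxsum p (e # es) H x = boxsum p es ((fdiff e ^^ (p - 1)) H) x
    + int p * boxsum p es (\<lambda>x. \<Sum>i<p-1. int ((p choose Suc i) div p) * (fdiff e ^^ i) H x) x"
proof -
  have p: "p > 0" using assms prime_gt_0_nat by blast
  have *: "(\<Sum>c<p. H (y + of_nat c * e)) = (\<Sum>i<p. int (p choose Suc i) * (fdiff e ^^ i) H y)" for y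
  proof -
    have "(\<Sum>c<p. H (y + of_nat c * e)) = (\<Sum>c<p. \<Sum>i<p. int (c choose i) * (fdiff e ^^ i) H y)"
    proof (intro sum.cong refl)
      fix c assume "c \<in> {..<p}"
      then have "(\<Sum>i\<le>c. int (c choose i) * (fdiff e ^^ i) H y) = (\<Sum>i<p. int (c choose i) * (fdiff e ^^ i) H y)"
        by (intro sum.mono_neutral_left) (auto simp: binomial_eq_0)
      then show "H (y + of_nat c * e) = (\<Sum>i<p. int (c choose i) * (fdiff e ^^ i) H y)"
        by (simp add: newton_forward)
    qed
    also have "\<dots> = (\<Sum>i<p. (\<Sum>c<p. int (c choose i)) * (fdiff e ^^ i) H y)"
      by (subst sum.swap) (simp add: sum_distrib_right)
    also have "\<dots> = (\<Sum>i<p. int (p choose Suc i) * (fdiff e ^^ i) H y)"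
    proof (intro sum.cong refl)
      fix i
      have "(\<Sum>c<p. c choose i) = p choose Suc i"
        using sum_choose_upper[of i "p - 1"] p by (simp add: lessThan_Suc_atMost[symmetric])
      then show "(\<Sum>c<p. int (c choose i)) * (fdiff e ^^ i) H y = int (p choose Suc i) * (fdiff e ^^ i) H y"
        by (metis of_nat_sum)
    qed
    finally show ?thesis .
  qed
  have "boxsum p (e # es) H x = boxsum p es (\<lambda>y. \<Sum>c<p. H (y + of_nat c * e)) x"
    by (simp add: boxsum_sum boxsum_shift)
  also have "(\<lambda>y. \<Sum>c<p. H (y + of_nat c * e)) = (\<lambda>y. (fdiff e ^^ (p - 1)) H y
      + int p * (\<Sum>i<p-1. int ((p choose Suc i) div p) * (fdiff e ^^ i) H y))"
  proof
    fix y
    have "(\<Sum>i<p. int (p choose Suc i) * (fdiff e ^^ i) H y)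
       = (\<Sum>i<Suc (p-1). int (p choose Suc i) * (fdiff e ^^ i) H y)" using p by simp
    also have "\<dots> = (\<Sum>i<p-1. int (p choose Suc i) * (fdiff e ^^ i) H y) + (fdiff e ^^ (p - 1)) H y"
      by (subst sum.lessThan_Suc) (use p in simp)
    also have "(\<Sum>i<p-1. int (p choose Suc i) * (fdiff e ^^ i) H y) =
        int p * (\<Sum>i<p-1. int ((p choose Suc i) div p) * (fdiff e ^^ i) H y)"
      unfolding sum_distrib_left
    proof (intro sum.cong refl)
      fix i assume "i \<in> {..<p-1}"
      then have "p dvd (p choose Suc i)" using assms by (intro dvd_choose_prime) auto
      then have "int (p choose Suc i) = int p * int ((p choose Suc i) div p)"
        by (metis dvd_mult_div_cancel of_nat_mult)
      then show "int (p choose Suc i) * (fdiff e ^^ i) H y = int p * (int ((p choose Suc i) div p) * (fdiff e ^^ i) H y)"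
        by simp
    qed
    finally show "(\<Sum>c<p. H (y + of_nat c * e)) = (fdiff e ^^ (p - 1)) H y
      + int p * (\<Sum>i<p-1. int ((p choose Suc i) div p) * (fdiff e ^^ i) H y)"
      using * by simp
  qed
  finally show ?thesis by (simp add: boxsum_add boxsum_cmult)
qed

text \<open>
  The source of all divisibility by \<open>p\<close>: a function of degree at most \<open>D\<close> can use up at most
  \<open>D / (p - 1)\<close> directions by lowering its degree, and each of the others yields a factor \<open>p\<close>.
\<close>

lemma boxsum_dvd:
  assumes "prime p" "deg_less s H" "s + (p - 1) * r \<le> (p - 1) * Suc (length es)"
  shows "int p ^ r dvd boxsum p es H x"
  using assms(2,3)
proof (induction es arbitrary: s H r)
  case Nil
  have p: "p \<ge> 2" using assms(1) prime_ge_2_nat by blast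
  consider "r = 0" | "r = 1" | "r \<ge> 2" by linarith
  then show ?case
  proof cases
    case 2
    with Nil(2) have "s = 0" by simp
    with Nil(1) 2 show ?thesis by simp
  next
    case 3
    then have "(p - 1) * 2 \<le> (p - 1) * r" by simp
    moreover have "(p - 1) * r \<le> p - 1" using Nil(2) by (simp only: list.size mult_1_right One_nat_def[symmetric])
    ultimately show ?thesis using p by linarith
  qed simp
next
  case (Cons e es)
  show ?case
  proof (cases "s = 0")
    case True
    with Cons.prems(1) have "H = (\<lambda>x. 0)" by (simp add: fun_eq_iff)
    then show ?thesis by (simp only: boxsum_zero dvd_0_right)
  next
    case False
    have "int p ^ r dvd boxsum p es ((fdiff e ^^ (p - 1)) H) x"
    proof (rule Cons.IH)
      show "deg_less (s - (p - 1)) ((fdiff e ^^ (p - 1)) H)"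
        using Cons.prems by (intro deg_less_fdiff_funpow)
      have "(p - 1) * r < (p - 1) * Suc (length (e # es))"
        using Cons.prems(2) False by linarith
      then have "r \<le> Suc (length es)"
        by (metis length_Cons less_Suc_eq_le mult_less_cancel1)
      then have "(p - 1) * r \<le> (p - 1) * Suc (length es)"
        by (rule mult_le_mono2)
      moreover have "(p - 1) * Suc (length (e # es)) = (p - 1) * Suc (length es) + (p - 1)"
        by simp
      ultimately show "s - (p - 1) + (p - 1) * r \<le> (p - 1) * Suc (length es)"
        using Cons.prems(2) by linarith
    qed
  moreover have "int p ^ r dvd int p * boxsum p es (\<lambda>x. \<Sum>i<p-1. int ((p choose Suc i) div p) * (fdiff e ^^ i) H x) x"
  proof (cases r)
    case (Suc r')
    have "deg_less s (\<lambda>x. \<Sum>i<p-1. int ((p choose Suc i) div p) * (fdiff e ^^ i) H x)"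
      using Cons.prems(1) by (intro deg_less_sum deg_less_cmult) (rule deg_less_mono[OF deg_less_fdiff_funpow diff_le_self])
    moreover have "s + (p - 1) * r' \<le> (p - 1) * Suc (length es)"
    proof -
      have "(p - 1) * Suc (length (e # es)) = (p - 1) * Suc (length es) + (p - 1)"
        and "(p - 1) * Suc r' = (p - 1) * r' + (p - 1)"
        by simp_all
      with Cons.prems(2) show ?thesis unfolding Suc by linarith
    qed
    ultimately have "int p ^ r' dvd boxsum p es (\<lambda>x. \<Sum>i<p-1. int ((p choose Suc i) div p) * (fdiff e ^^ i) H x) x"
      by (rule Cons.IH)
    then show ?thesis unfolding Suc power_Suc by (rule mult_dvd_mono[OF dvd_refl])
  qed simp
  ultimately show ?thesis
    unfolding boxsum_Cons_fdiff[OF assms(1)] by (rule dvd_add)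
  qed
qed

section \<open>Common zeros of integer-valued functions modulo a prime\<close>

lemma fdiff_apply: "fdiff a H x = H (x + a) - H x"
  by (simp add: fdiff_def)

lemma funpow_fdiff_cmult: "(fdiff a ^^ n) (\<lambda>x. c * H x) = (\<lambda>x. c * (fdiff a ^^ n) H x)"
  by (induction n) (auto simp: fdiff_def algebra_simps)

lemma funpow_fdiff_shift: "(fdiff a ^^ n) H (x + b) = (fdiff a ^^ n) (\<lambda>x. H (x + b)) x"
proof (induction n arbitrary: x)
  case (Suc n)
  have "(fdiff a ^^ n) H (x + b + a) = (fdiff a ^^ n) H (x + a + b)"
    by (simp only: ac_simps)
  moreover have "(fdiff a ^^ n) H (x + b) = (fdiff a ^^ n) (\<lambda>x. H (x + b)) x" for x
    by (rule Suc.IH)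
  ultimately show ?case
    by (simp add: fdiff_apply[of a "(fdiff a ^^ n) H"] fdiff_apply[of a "(fdiff a ^^ n) (\<lambda>x. H (x + b))"])
qed simp

text \<open>
  Fleck's congruence. For \<open>p\<close>-periodic functions the shift satisfies \<open>(1 + \<Delta>)\<^sup>p = 1\<close>, hence
  \<open>\<Delta>\<^sup>p = p \<Delta> h(\<Delta>)\<close> for some polynomial \<open>h\<close>: after the first difference, every further \<open>p - 1\<close>
  differences produce a factor \<open>p\<close>.
\<close>

lemma periodic_dvd_funpow_fdiff:
  fixes g :: "nat \<Rightarrow> int"
  assumes "prime p" "\<And>y. g (y + p) = g y" "j \<ge> 1 + t * (p - 1)"
  shows "int p ^ t dvd (fdiff 1 ^^ j) g y"
  using assms(2,3)
proof (induction t arbitrary: g j y)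
  case (Suc t)
  have p: "p \<ge> 2" using assms(1) prime_ge_2_nat by blast
  define h where "h = (\<lambda>y. - (\<Sum>i<p-1. int ((p choose Suc i) div p) * (fdiff 1 ^^ i) g y))"
  have h_per: "h (y + p) = h y" for y
    unfolding h_def funpow_fdiff_shift using Suc.prems(1) by simp
  \<comment> \<open>This is \<open>(1 + \<Delta>)\<^sup>p = 1\<close> solved for \<open>\<Delta>\<^sup>p\<close>.\<close>
  have dh: "(fdiff 1 ^^ p) g = (\<lambda>y. int p * fdiff 1 h y)"
  proof
    fix y
    have p_eq: "p = Suc (p - 1)" using p by simp
    have "g y = g (y + of_nat p * 1)" using Suc.prems(1) by simp
    also have "\<dots> = (\<Sum>i\<le>p. int (p choose i) * (fdiff 1 ^^ i) g y)"
      by (rule newton_forward)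
    also have "\<dots> = g y + (\<Sum>i<p. int (p choose Suc i) * (fdiff 1 ^^ Suc i) g y)"
      by (subst lessThan_Suc_atMost[symmetric], subst sum.lessThan_Suc_shift) simp
    also have "(\<Sum>i<p. int (p choose Suc i) * (fdiff 1 ^^ Suc i) g y)
        = (\<Sum>i<p-1. int (p choose Suc i) * (fdiff 1 ^^ Suc i) g y) + (fdiff 1 ^^ p) g y"
      using sum.lessThan_Suc[of "\<lambda>i. int (p choose Suc i) * (fdiff 1 ^^ Suc i) g y" "p - 1"] p_eq
      by (simp del: funpow.simps)
    also have "(\<Sum>i<p-1. int (p choose Suc i) * (fdiff 1 ^^ Suc i) g y)
        = (\<Sum>i<p-1. int p * (int ((p choose Suc i) div p) * (fdiff 1 ^^ Suc i) g y))"
    proof (intro sum.cong refl)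
      fix i assume "i \<in> {..<p-1}"
      then have "p dvd (p choose Suc i)" using assms by (intro dvd_choose_prime) auto
      then have "int (p choose Suc i) = int p * int ((p choose Suc i) div p)"
        by (metis dvd_mult_div_cancel of_nat_mult)
      then show "int (p choose Suc i) * (fdiff 1 ^^ Suc i) g y
          = int p * (int ((p choose Suc i) div p) * (fdiff 1 ^^ Suc i) g y)"
        by (simp del: funpow.simps)
    qed
    also have "\<dots> = - (int p * fdiff 1 h y)"
    proof -
      have "fdiff 1 h y = - (\<Sum>i<p-1. int ((p choose Suc i) div p) * (fdiff 1 ^^ Suc i) g y)"
        by (simp add: h_def fdiff_apply sum_subtractf right_diff_distrib)
      then show ?thesis by (simp add: sum_distrib_left del: funpow.simps)
    qed
    finally show "(fdiff 1 ^^ p) g y = int p * fdiff 1 h y" by simp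
  qed
  have "p \<le> j" using Suc.prems(2) p by simp
  then obtain r where j: "j = r + p" by (metis add.commute le_Suc_ex)
  have "p + t * (p - 1) \<le> j" using Suc.prems(2) p by simp
  with j have "Suc r \<ge> 1 + t * (p - 1)" by simp
  then have "int p ^ t dvd (fdiff 1 ^^ Suc r) h y"
    by (intro Suc.IH h_per)
  moreover have "(fdiff 1 ^^ j) g y = int p * (fdiff 1 ^^ Suc r) h y"
    unfolding j funpow_add comp_def dh funpow_fdiff_cmult by (simp add: funpow_swap1)
  ultimately show ?case by simp
qed simp

text \<open>
  The Newton coefficients of the indicator function of the multiples of \<open>p\<close>.
\<close>

definition dvd_coeff :: "nat \<Rightarrow> nat \<Rightarrow> int" where
  "dvd_coeff p j = (fdiff 1 ^^ j) (\<lambda>y::nat. of_bool (p dvd y)) 0"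

lemma dvd_coeff_dvd:
  assumes "prime p" "t * (p - 1) \<le> j - 1"
  shows "int p ^ t dvd dvd_coeff p j"
proof (cases "j = 0")
  case True
  with assms prime_ge_2_nat[of p] have "t = 0" by simp
  then show ?thesis by simp
next
  case False
  with assms show ?thesis
    unfolding dvd_coeff_def by (intro periodic_dvd_funpow_fdiff) auto
qed

text \<open>
  Modulo \<open>p ^ b\<close> the Newton expansion breaks off at an index independent of \<open>y\<close>, by Fleck's
  congruence.
\<close>

lemma of_bool_dvd_expansion:
  assumes "prime p"
  shows "int p ^ b dvd of_bool (p dvd y) - (\<Sum>j<Suc (b * (p - 1)). dvd_coeff p j * int (y choose j))"
proof -
  define J where "J = Suc (b * (p - 1))"
  have "of_bool (p dvd y) = (\<Sum>j\<le>y. dvd_coeff p j * int (y choose j))"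
    using newton_forward[of "\<lambda>y. of_bool (p dvd y)" 0 y 1]
    by (simp add: dvd_coeff_def mult.commute)
  also have "\<dots> = (\<Sum>j<J + Suc y. dvd_coeff p j * int (y choose j))"
    by (intro sum.mono_neutral_left) (auto simp: binomial_eq_0)
  also have "\<dots> = (\<Sum>j<J. dvd_coeff p j * int (y choose j))
      + (\<Sum>j=J..<J + Suc y. dvd_coeff p j * int (y choose j))"
    using sum.atLeastLessThan_concat[of 0 J "J + Suc y" "\<lambda>j. dvd_coeff p j * int (y choose j)"]
    by (simp add: lessThan_atLeast0)
  finally have "of_bool (p dvd y) - (\<Sum>j<J. dvd_coeff p j * int (y choose j))
      = (\<Sum>j=J..<J + Suc y. dvd_coeff p j * int (y choose j))" by simp
  also have "int p ^ b dvd \<dots>"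
    by (intro dvd_sum dvd_mult2 dvd_coeff_dvd assms) (auto simp: J_def)
  finally show ?thesis unfolding J_def .
qed

lemma prod_diff_dvd:
  fixes f g :: "'i \<Rightarrow> int"
  assumes "\<And>i. i \<in> I \<Longrightarrow> q dvd f i - g i"
  shows "q dvd (\<Prod>i\<in>I. f i) - (\<Prod>i\<in>I. g i)"
  using assms
proof (induction I rule: infinite_finite_induct)
  case (insert i I)
  have "(\<Prod>i\<in>insert i I. f i) - (\<Prod>i\<in>insert i I. g i)
      = (f i - g i) * (\<Prod>i\<in>I. f i) + g i * ((\<Prod>i\<in>I. f i) - (\<Prod>i\<in>I. g i))"
    using insert by (simp add: algebra_simps)
  with insert show ?case by simp
qed auto

text \<open>
  An Ax-Katz theorem over the prime field, for \<open>k\<close> equations of degree \<open>m\<close> in \<open>length es\<close>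
  variables; the hypothesis on the lengths says \<open>m * (k + b - 1) < length es\<close>. The indicator of
  the common zeros is a product of \<open>k\<close> Newton expansions. A typical term is a product of
  \<open>c\<^sub>j (F\<^sub>i choose j)\<close> over \<open>i < k\<close> with \<open>j\<close> depending on \<open>i\<close>; large \<open>j\<close> make the coefficients divisible by
  powers of \<open>p\<close>, small \<open>j\<close> keep the degree low, so that the box sum is divisible instead.
\<close>

lemma boxsum_common_multiples_dvd:
  fixes F :: "nat \<Rightarrow> 'a::comm_semiring_1 \<Rightarrow> nat"
  assumes p: "prime p" and m: "m \<ge> 1"
    and deg: "\<And>i. i < k \<Longrightarrow> deg_less (Suc m) (\<lambda>x. int (F i x))"
    and len: "m * (k + b) < length es + m"
  shows "int p ^ b dvd boxsum p es (\<lambda>x. \<Prod>i<k. of_bool (p dvd F i x)) x"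
proof -
  define J where "J = Suc (b * (p - 1))"
  define \<Phi> where "\<Phi> = PiE {..<k} (\<lambda>_. {..<J})"
  have p2: "p \<ge> 2" using p prime_ge_2_nat by blast
  let ?G = "\<lambda>x. \<Prod>i<k. \<Sum>j<J. dvd_coeff p j * int (F i x choose j)"
  let ?B = "\<lambda>\<phi> x. \<Prod>i<k. int (F i x choose \<phi> i)"
  have G: "?G = (\<lambda>x. \<Sum>\<phi>\<in>\<Phi>. (\<Prod>i<k. dvd_coeff p (\<phi> i)) * ?B \<phi> x)"
    unfolding \<Phi>_def by (subst prod_sum_PiE) (simp_all add: prod.distrib)
  have term_dvd: "int p ^ b dvd (\<Prod>i<k. dvd_coeff p (\<phi> i)) * boxsum p es (?B \<phi>) x" for \<phi> :: "nat \<Rightarrow> nat"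
  proof -
    \<comment> \<open>The exponents of \<open>p\<close> guaranteed by Fleck's congruence; truncated subtraction makes them \<open>0\<close> at \<open>\<phi> i = 0\<close>.\<close>
    define t where "t i = (\<phi> i - 1) div (p - 1)" for i
    define T where "T = (\<Sum>i<k. t i)"
    have "int p ^ T dvd (\<Prod>i<k. dvd_coeff p (\<phi> i))"
      unfolding T_def power_sum
      by (intro prod_dvd_prod dvd_coeff_dvd p) (auto simp: t_def)
    moreover have "int p ^ (b - T) dvd boxsum p es (?B \<phi>) x"
    proof (cases "T < b")
      case True
      have phi: "\<phi> i \<le> (p - 1) * (t i + 1)" for i
      proof -
        have "\<phi> i - 1 < (p - 1) * (t i + 1)"
          using p2 dividend_less_times_div[of "p - 1" "\<phi> i - 1"] by (simp add: t_def)
        then show ?thesis by linarith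
      qed
      have "(\<Sum>i<k. m * \<phi> i) \<le> (\<Sum>i<k. m * ((p - 1) * (t i + 1)))"
        by (intro sum_mono mult_le_mono2 phi)
      also have "\<dots> = m * ((p - 1) * (\<Sum>i<k. t i + 1))"
        by (simp only: sum_distrib_left)
      also have "\<dots> = (p - 1) * (m * (T + k))"
        by (simp add: T_def sum_distrib_left[symmetric] sum_Suc mult.left_commute)
      finally have D: "(\<Sum>i<k. m * \<phi> i) \<le> (p - 1) * (m * (T + k))" .
      \<comment> \<open>The left side is largest at \<open>T = b - 1\<close>, where the inequality is the hypothesis on the lengths.\<close>
      have N: "m * (T + k) + (b - T) \<le> length es"
      proof -
        obtain u where u: "b = Suc (T + u)" using True less_iff_Suc_add by auto
        have "u \<le> m * u" using m by simp
        moreover have "m * (k + b) = m * (T + k) + m * u + m"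
          by (simp add: u algebra_simps)
        moreover have "b - T = Suc u" using u by simp
        ultimately show ?thesis using len by linarith
      qed
      show ?thesis
      proof (rule boxsum_dvd[OF p])
        show "deg_less (Suc (\<Sum>i<k. m * \<phi> i)) (?B \<phi>)"
          by (intro deg_less_prod deg_less_binomial deg) auto
        have "Suc (\<Sum>i<k. m * \<phi> i) + (p - 1) * (b - T) \<le> (p - 1) * (m * (T + k) + (b - T) + 1)"
          using D p2 by (simp add: algebra_simps)
        also have "\<dots> \<le> (p - 1) * Suc (length es)"
          using N by (intro mult_le_mono2) simp
        finally show "Suc (\<Sum>i<k. m * \<phi> i) + (p - 1) * (b - T) \<le> (p - 1) * Suc (length es)" .
      qed
    qed simp
    ultimately have "int p ^ T * int p ^ (b - T) dvd (\<Prod>i<k. dvd_coeff p (\<phi> i)) * boxsum p es (?B \<phi>) x"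
      by (rule mult_dvd_mono)
    moreover have "int p ^ b dvd int p ^ T * int p ^ (b - T)"
      unfolding power_add[symmetric] by (rule le_imp_power_dvd) simp
    ultimately show ?thesis by (rule dvd_trans[rotated])
  qed
  have "int p ^ b dvd boxsum p es ?G x"
    unfolding G boxsum_sum boxsum_cmult by (intro dvd_sum term_dvd)
  moreover have "int p ^ b dvd boxsum p es (\<lambda>x. \<Prod>i<k. of_bool (p dvd F i x)) x - boxsum p es ?G x"
    unfolding J_def by (intro boxsum_cong_dvd prod_diff_dvd of_bool_dvd_expansion p)
  ultimately show ?thesis by (simp add: dvd_diff_left_iff)
qed

section \<open>Groups of prime exponent and polynomial functions into finite rings\<close>

text \<open>
  The additive monoid generated by a list. In characteristic \<open>p\<close> this is the span over the prime
  field, and \<open>nindep\<close> below is linear independence over it; natural multiples avoid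
  introducing that field as a type.
\<close>

primrec nspan :: "'a::comm_ring_1 list \<Rightarrow> 'a set" where
  "nspan [] = {0}"
| "nspan (g # gs) = {of_nat c * g + y |c y. y \<in> nspan gs}"

primrec nindep :: "'a::comm_ring_1 list \<Rightarrow> bool" where
  "nindep [] \<longleftrightarrow> True"
| "nindep (g # gs) \<longleftrightarrow> g \<notin> nspan gs \<and> nindep gs"

lemma nspan_0 [simp]: "0 \<in> nspan gs"
  by (induction gs) (auto intro: exI[of _ 0])

lemma nspan_add: "x \<in> nspan gs \<Longrightarrow> y \<in> nspan gs \<Longrightarrow> x + y \<in> nspan gs"
proof (induction gs arbitrary: x y)
  case (Cons g gs)
  then obtain c d u v where "x = of_nat c * g + u" "u \<in> nspan gs" "y = of_nat d * g + v" "v \<in> nspan gs"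
    by auto
  then have "x + y = of_nat (c + d) * g + (u + v)" "u + v \<in> nspan gs"
    using Cons.IH by (auto simp: algebra_simps)
  then show ?case unfolding nspan.simps by blast
qed simp

lemma nspan_of_nat_mult: "x \<in> nspan gs \<Longrightarrow> of_nat c * x \<in> nspan gs"
  by (induction c) (auto simp: distrib_right intro: nspan_add)

lemma nspan_iff:
  "y \<in> nspan gs \<longleftrightarrow> (\<exists>c. y = (\<Sum>i<length gs. of_nat (c i) * gs ! i))"
proof (induction gs arbitrary: y)
  case (Cons g gs)
  have "y \<in> nspan (g # gs) \<longleftrightarrow> (\<exists>d c. y = of_nat d * g + (\<Sum>i<length gs. of_nat (c i) * gs ! i))"
    using Cons.IH by auto
  also have "\<dots> \<longleftrightarrow> (\<exists>c. y = (\<Sum>i<length (g # gs). of_nat (c i) * (g # gs) ! i))"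
  proof safe
    fix d c
    have "of_nat d * g + (\<Sum>i<length gs. of_nat (c i) * gs ! i)
        = (\<Sum>i<length (g # gs). of_nat (case i of 0 \<Rightarrow> d | Suc i \<Rightarrow> c i) * (g # gs) ! i)"
      by (simp add: sum.lessThan_Suc_shift del: sum.lessThan_Suc)
    then show "\<exists>c'. of_nat d * g + (\<Sum>i<length gs. of_nat (c i) * gs ! i)
        = (\<Sum>i<length (g # gs). of_nat (c' i) * (g # gs) ! i)" by blast
  next
    fix c
    have "(\<Sum>i<length (g # gs). of_nat (c i) * (g # gs) ! i)
        = of_nat (c 0) * g + (\<Sum>i<length gs. of_nat (c (Suc i)) * gs ! i)"
      by (simp add: sum.lessThan_Suc_shift del: sum.lessThan_Suc)
    then show "\<exists>d c'. (\<Sum>i<length (g # gs). of_nat (c i) * (g # gs) ! i)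
        = of_nat d * g + (\<Sum>i<length gs. of_nat (c' i) * gs ! i)" by (intro exI[of _ "c 0"] exI[of _ "\<lambda>i. c (Suc i)"])
  qed
  finally show ?case .
qed simp

context
  fixes p :: nat
  assumes prime: "prime p"
begin

lemma nspan_minus:
  assumes "of_nat p = (0::'a::comm_ring_1)" "(y::'a) \<in> nspan gs"
  shows "- y \<in> nspan gs"
proof -
  have "of_nat (p - 1) * y + y = of_nat p * y"
    using prime_gt_0_nat[OF prime] by (simp add: of_nat_diff algebra_simps)
  then have "- y = of_nat (p - 1) * y"
    using assms(1) by (metis add.commute minus_unique mult_zero_left)
  with assms(2) show ?thesis by (simp add: nspan_of_nat_mult)
qed

lemma of_nat_mult_in_nspanD:
  assumes "of_nat p = (0::'a::comm_ring_1)" "(g::'a) \<notin> nspan gs" "of_nat c * g \<in> nspan gs"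
  shows "p dvd c"
proof (rule ccontr)
  assume "\<not> p dvd c"
  with prime have "gcd c p = 1"
    by (metis coprime_commute coprime_iff_gcd_eq_1 prime_imp_coprime)
  moreover have "c \<noteq> 0" using \<open>\<not> p dvd c\<close> by (metis dvd_0_right)
  ultimately obtain u v where uv: "c * u = p * v + 1"
    using bezout_nat[of c p] by auto
  have "of_nat u * (of_nat c * g) = of_nat (c * u) * g"
    by (simp add: algebra_simps)
  also have "\<dots> = g"
    unfolding uv by (simp add: assms(1))
  finally have "g \<in> nspan gs"
    using nspan_of_nat_mult[OF assms(3), of u] by simp
  with assms(2) show False by simp
qed

lemma nindep_bij:
  assumes "of_nat p = (0::'a::comm_ring_1)" "(g::'a) \<notin> nspan gs"
  shows "bij_betw (\<lambda>(c, y). of_nat c * g + y) ({..<p} \<times> nspan gs) (nspan (g # gs))"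
  unfolding bij_betw_def
proof
  have aux: "c = c'" if c: "c < p" "c' < p" "c \<le> c'" and y: "y \<in> nspan gs" "y' \<in> nspan gs"
    and eq: "of_nat c * g + y = of_nat c' * g + y'" for c c' :: nat and y y'
  proof -
    have "of_nat (c' - c) * g = y + - y'"
      using eq c by (simp add: of_nat_diff algebra_simps)
    also have "\<dots> \<in> nspan gs"
      by (intro nspan_add nspan_minus y assms)
    finally have "p dvd c' - c"
      using assms of_nat_mult_in_nspanD by blast
    with c show ?thesis
      by (metis diff_is_0_eq dual_order.antisym less_imp_diff_less nat_dvd_not_less zero_less_iff_neq_zero)
  qed
  show "inj_on (\<lambda>(c, y). of_nat c * g + y) ({..<p} \<times> nspan gs)"
  proof (rule inj_onI, clarsimp)
    fix c y c' y'
    assume *: "c < p" "y \<in> nspan gs" "c' < p" "y' \<in> nspan gs" "of_nat c * g + y = of_nat c' * g + y'"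
    then have "c = c'"
      using aux[of c c' y y'] aux[of c' c y' y] by (cases "c \<le> c'") auto
    with * show "c = c' \<and> y = y'" by auto
  qed
  show "(\<lambda>(c, y). of_nat c * g + y) ` ({..<p} \<times> nspan gs) = nspan (g # gs)"
  proof safe
    fix z assume "z \<in> nspan (g # gs)"
    then obtain c y where z: "z = of_nat c * g + y" "y \<in> nspan gs" by auto
    have "of_nat c = (of_nat (c mod p) :: 'a)"
    proof -
      have "of_nat c = (of_nat (p * (c div p) + c mod p) :: 'a)" by simp
      also have "\<dots> = of_nat (c mod p)" unfolding of_nat_add of_nat_mult assms(1) by simp
      finally show ?thesis .
    qed
    with z have "z = (\<lambda>(c, y). of_nat c * g + y) (c mod p, y)" by simp
    moreover have "(c mod p, y) \<in> {..<p} \<times> nspan gs"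
      using z prime_gt_0_nat[OF prime] by simp
    ultimately show "z \<in> (\<lambda>(c, y). of_nat c * g + y) ` ({..<p} \<times> nspan gs)" by blast
  qed auto
qed

lemma card_nspan:
  assumes "of_nat p = (0::'a::comm_ring_1)" "nindep (gs :: 'a list)"
  shows "finite (nspan gs) \<and> card (nspan gs) = p ^ length gs"
  using assms(2)
proof (induction gs)
  case (Cons g gs)
  then have "bij_betw (\<lambda>(c, y). of_nat c * g + y) ({..<p} \<times> nspan gs) (nspan (g # gs))"
    using assms(1) by (intro nindep_bij) auto
  with Cons show ?case
    using bij_betw_finite bij_betw_same_card by (fastforce simp: card_cartesian_product)
qed simp

lemma boxsum_eq_sum_nspan:
  assumes "of_nat p = (0::'a::comm_ring_1)" "nindep (gs :: 'a list)"
  shows "boxsum p gs H x = (\<Sum>y\<in>nspan gs. H (x + y))"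
  using assms(2)
proof (induction gs arbitrary: x)
  case (Cons g gs)
  then have "bij_betw (\<lambda>(c, y). of_nat c * g + y) ({..<p} \<times> nspan gs) (nspan (g # gs))"
    using assms(1) by (intro nindep_bij) auto
  then have "(\<Sum>y\<in>nspan (g # gs). H (x + y)) = (\<Sum>(c, y)\<in>{..<p} \<times> nspan gs. H (x + (of_nat c * g + y)))"
    by (subst sum.reindex_bij_betw[symmetric]) (auto simp: case_prod_unfold)
  also have "\<dots> = (\<Sum>c<p. \<Sum>y\<in>nspan gs. H (x + (of_nat c * g + y)))"
    by (simp add: sum.cartesian_product)
  also have "\<dots> = boxsum p (g # gs) H x"
    using Cons by (simp add: add.assoc)
  finally show ?case by simp
qed simp

lemma nindep_coeffs_dvd:
  assumes "of_nat p = (0::'a::comm_ring_1)" "nindep (gs :: 'a list)"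
    and "(\<Sum>i<length gs. of_nat (c i) * gs ! i) = 0" "i < length gs"
  shows "p dvd c i"
  using assms(2-)
proof (induction gs arbitrary: c i)
  case (Cons g gs)
  define y where "y = (\<Sum>i<length gs. of_nat (c (Suc i)) * gs ! i)"
  have y: "y \<in> nspan gs" unfolding y_def nspan_iff by (intro exI[of _ "\<lambda>i. c (Suc i)"] refl)
  have eq: "of_nat (c 0) * g + y = 0"
    using Cons.prems(2) by (simp add: y_def sum.lessThan_Suc_shift del: sum.lessThan_Suc)
  then have "of_nat (c 0) * g = - y" by (simp add: eq_neg_iff_add_eq_0)
  then have "of_nat (c 0) * g \<in> nspan gs" using nspan_minus[OF assms(1) y] by simp
  then have c0: "p dvd c 0"
    using Cons.prems(1) assms(1) of_nat_mult_in_nspanD by auto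
  then have "of_nat (c 0) = (0::'a)" using assms(1) by (auto simp: dvd_def)
  with eq have "y = 0" by simp
  then have "j < length gs \<Longrightarrow> p dvd c (Suc j)" for j
    using Cons.IH[of "\<lambda>i. c (Suc i)" j] Cons.prems(1) by (simp add: y_def)
  with c0 Cons.prems(3) show ?case by (cases i) auto
qed simp

text \<open>
  An independent list that does not yet generate \<open>G\<close> stays independent when a missing element is
  adjoined.
\<close>

lemma exists_nindep_nspan_eq:
  assumes "of_nat p = (0::'a::comm_ring_1)" "finite (G :: 'a set)" "0 \<in> G"
    and add: "\<And>x y. x \<in> G \<Longrightarrow> y \<in> G \<Longrightarrow> x + y \<in> G"
  shows "\<exists>gs. nindep gs \<and> nspan gs = G"
proof -
  have mult: "of_nat c * x \<in> G" if "x \<in> G" for c x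
    using that assms(3) by (induction c) (auto simp: distrib_right intro: add)
  have "\<exists>gs. nindep gs \<and> nspan gs = G" if "nindep hs" "nspan hs \<subseteq> G" for hs
    using that
  proof (induction "card (G - nspan hs)" arbitrary: hs rule: less_induct)
    case less
    show ?case
    proof (cases "nspan hs = G")
      case False
      with less.prems obtain g where g: "g \<in> G" "g \<notin> nspan hs" by auto
      have "nspan (g # hs) \<subseteq> G" using less.prems g by (auto intro: add mult)
      moreover have "nspan hs \<subseteq> nspan (g # hs)" by (auto intro: exI[of _ 0])
      moreover have "g \<in> nspan (g # hs)"
      proof -
        have "of_nat 1 * g + 0 \<in> nspan (g # hs)" unfolding nspan.simps using nspan_0 by blast
        then show ?thesis by (simp del: nspan.simps)
      qed
      ultimately have "G - nspan (g # hs) \<subset> G - nspan hs"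
        using g by blast
      then have "card (G - nspan (g # hs)) < card (G - nspan hs)"
        using assms(2) by (intro psubset_card_mono) auto
      then show ?thesis
        using less.hyps[of "g # hs"] less.prems g \<open>nspan (g # hs) \<subseteq> G\<close> by auto
    qed (use less.prems in auto)
  qed
  from this[of "[]"] assms(3) show ?thesis by simp
qed

end

text \<open>
  If \<open>\<epsilon>\<close> is a basis of \<open>'k\<close> over its prime field, the functions \<open>F i\<close> lift the coordinates of \<open>P\<close>
  to natural numbers. The degree bound is imposed on the lifts, since the Newton expansion of
  divisibility by \<open>p\<close> needs integer arguments. The domain of \<open>P\<close> should accordingly be free, such as
  functions to \<open>\<nat>\<close>; on a group of exponent \<open>p\<close> a non-constant lift has no finite degree.
\<close>

definition lifts :: "'k::comm_ring_1 list \<Rightarrow> nat \<Rightarrow> ('a::comm_semiring_1 \<Rightarrow> 'k) \<Rightarrow> bool" where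
  "lifts \<epsilon> D P \<longleftrightarrow> (\<exists>F. (\<forall>i<length \<epsilon>. deg_less (Suc D) (\<lambda>x. int (F i x))) \<and>
     (\<forall>x. P x = (\<Sum>i<length \<epsilon>. of_nat (F i x) * \<epsilon> ! i)))"

lemma lifts_add:
  assumes "lifts \<epsilon> D P" "lifts \<epsilon> D Q"
  shows "lifts \<epsilon> D (\<lambda>x. P x + Q x)"
proof -
  from assms obtain F G where
    F: "\<forall>i<length \<epsilon>. deg_less (Suc D) (\<lambda>x. int (F i x))" "\<forall>x. P x = (\<Sum>i<length \<epsilon>. of_nat (F i x) * \<epsilon> ! i)" and
    G: "\<forall>i<length \<epsilon>. deg_less (Suc D) (\<lambda>x. int (G i x))" "\<forall>x. Q x = (\<Sum>i<length \<epsilon>. of_nat (G i x) * \<epsilon> ! i)"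
    unfolding lifts_def by blast
  show ?thesis
    unfolding lifts_def
  proof (intro exI[of _ "\<lambda>i x. F i x + G i x"] conjI allI impI)
    fix i assume "i < length \<epsilon>"
    with F G show "deg_less (Suc D) (\<lambda>x. int (F i x + G i x))"
      unfolding of_nat_add by (intro deg_less_add) auto
  next
    fix x show "P x + Q x = (\<Sum>i<length \<epsilon>. of_nat (F i x + G i x) * \<epsilon> ! i)"
      by (simp add: F(2) G(2) sum.distrib distrib_right)
  qed
qed

lemma lifts_const:
  assumes "nspan \<epsilon> = UNIV"
  shows "lifts \<epsilon> D (\<lambda>x. a)"
proof -
  from assms obtain c where c: "a = (\<Sum>i<length \<epsilon>. of_nat (c i) * \<epsilon> ! i)"
    using nspan_iff[of a \<epsilon>] by auto
  then show ?thesis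
    unfolding lifts_def
    by (intro exI[of _ "\<lambda>i x. c i"] conjI allI impI deg_less_const) auto
qed

lemma lifts_sum:
  assumes "nspan \<epsilon> = UNIV" "\<And>i. i \<in> I \<Longrightarrow> lifts \<epsilon> D (P i)"
  shows "lifts \<epsilon> D (\<lambda>x. \<Sum>i\<in>I. P i x)"
  using assms(2)
  by (induction I rule: infinite_finite_induct) (auto intro: lifts_add lifts_const[OF assms(1)])

text \<open>
  Lifting the structure constants of \<open>'k\<close> with respect to \<open>\<epsilon>\<close> to natural numbers gives a bilinear
  product on the lifted coordinates. It need not be associative, but only bilinearity matters for
  the degree.
\<close>

lemma lifts_mult:
  fixes P :: "'a::comm_semiring_1 \<Rightarrow> 'k::comm_ring_1"
  assumes "nspan \<epsilon> = UNIV" "lifts \<epsilon> D P" "lifts \<epsilon> E Q"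
  shows "lifts \<epsilon> (D + E) (\<lambda>x. P x * Q x)"
proof -
  define n where "n = length \<epsilon>"
  from assms obtain F G where
    F: "\<forall>i<n. deg_less (Suc D) (\<lambda>x. int (F i x))" "\<forall>x. P x = (\<Sum>i<n. of_nat (F i x) * \<epsilon> ! i)" and
    G: "\<forall>i<n. deg_less (Suc E) (\<lambda>x. int (G i x))" "\<forall>x. Q x = (\<Sum>i<n. of_nat (G i x) * \<epsilon> ! i)"
    unfolding lifts_def n_def by blast
  have "\<forall>i j. \<exists>c. \<epsilon> ! i * \<epsilon> ! j = (\<Sum>l<n. of_nat (c l) * \<epsilon> ! l)"
    using assms(1) nspan_iff[of _ \<epsilon>] unfolding n_def by auto
  then obtain s where s: "\<And>i j. \<epsilon> ! i * \<epsilon> ! j = (\<Sum>l<n. of_nat (s i j l) * \<epsilon> ! l)"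
    by metis
  show ?thesis
    unfolding lifts_def n_def[symmetric]
  proof (intro exI[of _ "\<lambda>l x. \<Sum>i<n. \<Sum>j<n. s i j l * (F i x * G j x)"] conjI allI impI)
    fix l assume "l < n"
    show "deg_less (Suc (D + E)) (\<lambda>x. int (\<Sum>i<n. \<Sum>j<n. s i j l * (F i x * G j x)))"
      unfolding of_nat_sum of_nat_mult
      using F(1) G(1) by (intro deg_less_sum deg_less_cmult deg_less_mult[of "Suc D" _ "Suc E"]) auto
  next
    fix x
    have "P x * Q x = (\<Sum>i<n. \<Sum>j<n. of_nat (F i x * G j x) * (\<epsilon> ! i * \<epsilon> ! j))"
      by (simp add: F(2) G(2) sum_product algebra_simps)
    also have "\<dots> = (\<Sum>i<n. \<Sum>j<n. \<Sum>l<n. of_nat (s i j l * (F i x * G j x)) * \<epsilon> ! l)"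
      by (simp add: s sum_distrib_left algebra_simps)
    also have "\<dots> = (\<Sum>i<n. \<Sum>l<n. \<Sum>j<n. of_nat (s i j l * (F i x * G j x)) * \<epsilon> ! l)"
      by (intro sum.cong refl sum.swap)
    also have "\<dots> = (\<Sum>l<n. \<Sum>i<n. \<Sum>j<n. of_nat (s i j l * (F i x * G j x)) * \<epsilon> ! l)"
      by (rule sum.swap)
    also have "\<dots> = (\<Sum>l<n. of_nat (\<Sum>i<n. \<Sum>j<n. s i j l * (F i x * G j x)) * \<epsilon> ! l)"
      by (simp only: of_nat_sum sum_distrib_right)
    finally show "P x * Q x = (\<Sum>l<n. of_nat (\<Sum>i<n. \<Sum>j<n. s i j l * (F i x * G j x)) * \<epsilon> ! l)" .
  qed
qed

lemma lifts_additive: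
  fixes \<chi> :: "'g \<Rightarrow> 'k::comm_ring_1"
  assumes "nspan \<epsilon> = UNIV"
  shows "lifts \<epsilon> 1 (\<lambda>x :: 'g \<Rightarrow> nat. \<Sum>g\<in>B. of_nat (x g) * \<chi> g)"
proof (rule lifts_sum[OF assms])
  fix g
  obtain c where c: "\<chi> g = (\<Sum>i<length \<epsilon>. of_nat (c i) * \<epsilon> ! i)"
    using assms nspan_iff[of "\<chi> g" \<epsilon>] by auto
  have "deg_less 2 (\<lambda>x :: 'g \<Rightarrow> nat. int (x g) * int (c i))" for i
    by (simp add: fdiff_def numeral_2_eq_2 algebra_simps)
  then show "lifts \<epsilon> 1 (\<lambda>x :: 'g \<Rightarrow> nat. of_nat (x g) * \<chi> g)"
    unfolding lifts_def
    by (intro exI[of _ "\<lambda>i x. x g * c i"]) (auto simp: c sum_distrib_left algebra_simps numeral_2_eq_2)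
qed

lemma boxsum_lifts_zeros_dvd:
  fixes P :: "'a::comm_semiring_1 \<Rightarrow> 'k::comm_ring_1"
  assumes "prime p" "of_nat p = (0::'k)" "nindep \<epsilon>" "lifts \<epsilon> m P" "m \<ge> 1"
    and "m * (length \<epsilon> + b) < length es + m"
  shows "int p ^ b dvd boxsum p es (\<lambda>x. of_bool (P x = 0)) x"
proof -
  obtain F where F: "\<And>i. i < length \<epsilon> \<Longrightarrow> deg_less (Suc m) (\<lambda>x. int (F i x))"
      "\<And>x. P x = (\<Sum>i<length \<epsilon>. of_nat (F i x) * \<epsilon> ! i)"
    using assms(4) unfolding lifts_def by blast
  have "(\<lambda>x. of_bool (P x = 0)) = (\<lambda>x. \<Prod>i<length \<epsilon>. of_bool (p dvd F i x) :: int)"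
  proof
    fix x
    have "P x = 0 \<longleftrightarrow> (\<forall>i<length \<epsilon>. p dvd F i x)"
    proof
      assume "P x = 0"
      then show "\<forall>i<length \<epsilon>. p dvd F i x"
        using nindep_coeffs_dvd[OF assms(1,2,3)] F(2) by metis
    next
      assume "\<forall>i<length \<epsilon>. p dvd F i x"
      then have "\<forall>i<length \<epsilon>. of_nat (F i x) = (0::'k)" using assms(2) by (auto simp: dvd_def)
      then show "P x = 0" using F(2) by simp
    qed
    then show "of_bool (P x = 0) = (\<Prod>i<length \<epsilon>. of_bool (p dvd F i x) :: int)"
      by (auto simp: of_bool_def)
  qed
  then show ?thesis
    using boxsum_common_multiples_dvd[OF assms(1,5) F(1) assms(6)] by simp
qed

text \<open>
  The group \<open>G\<close> is covered by the free monoid of functions \<open>'g \<Rightarrow> nat\<close>, whose unit vectors map to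
  a basis of \<open>G\<close>. The box spanned by these unit vectors maps bijectively to \<open>G\<close>, so the zeros of
  \<open>P\<close> on \<open>G\<close> are counted by a box sum of a function with a lift.
\<close>

lemma card_zeros_dvd:
  fixes G :: "'g::comm_ring_1 set" and P :: "'g \<Rightarrow> 'k::comm_ring_1"
  assumes p: "prime p" "of_nat p = (0::'k)" "of_nat p = (0::'g)"
    and \<epsilon>: "nindep \<epsilon>" "nspan \<epsilon> = UNIV"
    and G: "finite G" "0 \<in> G" "\<And>x y. x \<in> G \<Longrightarrow> y \<in> G \<Longrightarrow> x + y \<in> G"
    and P: "\<And>B. lifts \<epsilon> m (\<lambda>x :: 'g \<Rightarrow> nat. P (\<Sum>g\<in>B. of_nat (x g) * g))" and "m \<ge> 1"
    and card: "card G = p ^ N" "m * (length \<epsilon> + b) < N + m"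
  shows "p ^ b dvd card {g \<in> G. P g = 0}"
proof -
  obtain gs where gs: "nindep gs" "nspan gs = G"
    using exists_nindep_nspan_eq[OF p(1,3) G] by blast
  then have "p ^ length gs = p ^ N" using card card_nspan[OF p(1,3)] by metis
  then have len: "length gs = N" using prime_gt_1_nat[OF p(1)] by simp
  define e where "e g = (\<lambda>h::'g. of_bool (h = g) :: nat)" for g
  define \<phi> where "\<phi> x = (\<Sum>g\<in>set gs. of_nat (x g) * g)" for x :: "'g \<Rightarrow> nat"
  have \<phi>: "\<phi> (x + of_nat c * e g) = \<phi> x + of_nat c * g" if "g \<in> set gs" for x c g
  proof -
    have "\<phi> (x + of_nat c * e g) = \<phi> x + (\<Sum>h\<in>set gs. of_nat c * (of_bool (h = g) * h))"
      by (simp add: \<phi>_def e_def sum.distrib algebra_simps)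
    also have "(\<Sum>h\<in>set gs. of_nat c * (of_bool (h = g) * h)) = (\<Sum>h\<in>{g}. of_nat c * (of_bool (h = g) * h))"
      using that by (intro sum.mono_neutral_right) auto
    also have "\<dots> = of_nat c * g" by simp
    finally show ?thesis .
  qed
  have box: "boxsum p (map e hs) (\<lambda>x. H (\<phi> x)) x = boxsum p hs H (\<phi> x)" if "set hs \<subseteq> set gs" for hs H x
    using that by (induction hs arbitrary: x) (auto simp: \<phi>)
  have "int p ^ b dvd boxsum p (map e gs) (\<lambda>x. of_bool (P (\<phi> x) = 0)) 0"
  proof (rule boxsum_lifts_zeros_dvd[OF p(1,2) \<epsilon>(1) _ \<open>m \<ge> 1\<close>])
    show "lifts \<epsilon> m (\<lambda>x. P (\<phi> x))" unfolding \<phi>_def by (rule P)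
  qed (use card len in simp)
  also have "boxsum p (map e gs) (\<lambda>x. of_bool (P (\<phi> x) = 0)) 0 = boxsum p gs (\<lambda>g. of_bool (P g = 0)) (\<phi> 0)"
    by (rule box) simp
  also have "\<dots> = (\<Sum>g\<in>G. of_bool (P g = 0))"
    by (simp add: boxsum_eq_sum_nspan[OF p(1,3) gs(1)] gs(2) \<phi>_def)
  also have "\<dots> = int (card {g \<in> G. P g = 0})"
    using G(1) by (simp add: sum.If_cases of_bool_def Int_def)
  finally show ?thesis by (metis of_nat_dvd_iff of_nat_power)
qed

section \<open>The Pfaffian of an alternating form\<close>

abbreviation delete_nth :: "nat \<Rightarrow> 'a list \<Rightarrow> 'a list" where
  "delete_nth i xs \<equiv> take i xs @ drop (Suc i) xs"

text \<open>
  The Pfaffian of the Gram matrix of a list of vectors, expanded along its first row. Its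
  dependence on the form \<open>f\<close> shows the degree; its dependence on the vectors, for a fixed alternating form, is
  that of an alternating multilinear map.
\<close>

fun pfaffian :: "('v \<Rightarrow> 'v \<Rightarrow> 'k::comm_ring_1) \<Rightarrow> 'v list \<Rightarrow> 'k" where
  "pfaffian f [] = 1"
| "pfaffian f (v # vs) = (\<Sum>i<length vs. (-1) ^ i * f v (vs ! i) * pfaffian f (delete_nth i vs))"

declare pfaffian.simps(2) [simp del]

lemma sum_lessThan_add:
  fixes a b :: nat
  shows "(\<Sum>i<a + b. g i) = (\<Sum>i<a. g i) + (\<Sum>j<b. g (a + j) :: 'a::comm_monoid_add)"
  by (induction b) (auto simp: ac_simps)

text \<open>
  The row expansion split at a given position of the list, so that the effect of changing an
  entry there can be read off.
\<close>

lemma pfaffian_Cons_append: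
  "pfaffian f (y # as @ bs) = (\<Sum>i<length as. (-1) ^ i * f y (as ! i) * pfaffian f (delete_nth i as @ bs))
     + (\<Sum>j<length bs. (-1) ^ (length as + j) * f y (bs ! j) * pfaffian f (as @ delete_nth j bs))"
proof -
  have "pfaffian f (y # as @ bs) = (\<Sum>i<length as + length bs. (-1) ^ i * f y ((as @ bs) ! i) * pfaffian f (delete_nth i (as @ bs)))"
    by (simp add: pfaffian.simps(2))
  also have "\<dots> = (\<Sum>i<length as. (-1) ^ i * f y ((as @ bs) ! i) * pfaffian f (delete_nth i (as @ bs)))
      + (\<Sum>j<length bs. (-1) ^ (length as + j) * f y ((as @ bs) ! (length as + j)) * pfaffian f (delete_nth (length as + j) (as @ bs)))"
    by (rule sum_lessThan_add)
  finally show ?thesis by (simp add: nth_append)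
qed

lemma pfaffian_Cons_append_Cons:
  "pfaffian f (y # as @ z # bs) = (\<Sum>i<length as. (-1) ^ i * f y (as ! i) * pfaffian f (delete_nth i as @ z # bs))
     + (-1) ^ length as * f y z * pfaffian f (as @ bs)
     + (\<Sum>j<length bs. (-1) ^ Suc (length as + j) * f y (bs ! j) * pfaffian f (as @ z # delete_nth j bs))"
  unfolding pfaffian_Cons_append by (simp add: sum.lessThan_Suc_shift algebra_simps del: sum.lessThan_Suc)

lemma pfaffian_eq_0_if_radical_mem:
  assumes "u \<in> set vs" "\<And>v. f u v = 0" "\<And>v. f v u = 0"
  shows "pfaffian f vs = 0"
  using assms(1)
proof (induction vs rule: length_induct)
  case (1 vs)
  then obtain v vs' where vs: "vs = v # vs'" by (cases vs) auto
  show ?case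
  proof (cases "v = u")
    case True
    then show ?thesis by (simp add: vs assms pfaffian.simps(2))
  next
    case False
    have "f v (vs' ! i) * pfaffian f (delete_nth i vs') = 0" if i: "i < length vs'" for i
    proof (cases "vs' ! i = u")
      case True
      then show ?thesis by (simp add: assms)
    next
      case ne: False
      have "u \<in> set vs'" using 1(2) False vs by simp
      then have "u \<in> set (take i vs' @ vs' ! i # drop (Suc i) vs')"
        using id_take_nth_drop[OF i] by simp
      then have "u \<in> set (delete_nth i vs')" using ne by auto
      moreover have "length (delete_nth i vs') < length vs" using vs by simp
      ultimately show ?thesis using 1(1) by (metis mult_zero_right)
    qed
    then show ?thesis by (simp add: vs mult.assoc pfaffian.simps(2))
  qed
qed

lemma nth_delete_nth:
  assumes "i < length ys" "j < length ys - 1"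
  shows "delete_nth i ys ! j = (if j < i then ys ! j else ys ! Suc j)"
  using assms by (auto simp: nth_append min_def)

lemma delete_nth_delete_nth:
  assumes "i < j" "j < length ys"
  shows "delete_nth (j - 1) (delete_nth i ys) = delete_nth i (delete_nth j ys)"
proof -
  define bs where "bs = take j ys"
  have len: "length bs = j" using assms(2) by (simp add: bs_def)
  have "ys = bs @ ys ! j # drop (Suc j) ys"
    unfolding bs_def using assms(2) by (rule id_take_nth_drop)
  also have "bs = take i bs @ bs ! i # drop (Suc i) bs"
    using assms(1) len by (intro id_take_nth_drop) simp
  finally have split: "ys = take i bs @ bs ! i # drop (Suc i) bs @ ys ! j # drop (Suc j) ys"
    by (simp only: append_assoc append_Cons)
  obtain as x cs y ds where
    ys: "ys = as @ x # cs @ y # ds" and i: "i = length as" and j: "j = Suc (length as + length cs)"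
    by (rule that[OF split]) (use assms len in simp_all)
  show ?thesis unfolding ys i j by simp
qed

text \<open>
  Expanding along both copies of \<open>x\<close> gives a sum over ordered pairs of positions of \<open>ys\<close>. The two
  orders of deleting a pair leave the same list, and they occur with opposite signs.
\<close>

lemma pfaffian_Cons_Cons_same:
  fixes f :: "'v \<Rightarrow> 'v \<Rightarrow> 'k::comm_ring_1"
  assumes "f x x = 0"
  shows "pfaffian f (x # x # ys) = 0"
proof -
  define n where "n = length ys"
  define T where "T i j = (-1) ^ (i + j) * f x (ys ! i) * f x (ys ! j) * pfaffian f (delete_nth i (delete_nth j ys))" for i j
  have inner: "(-1) ^ i * f x (ys ! i) * pfaffian f (x # delete_nth i ys)
      = (\<Sum>j<n. if j < i then T j i else 0) - (\<Sum>j<n. if i < j then T i j else 0)" if i: "i < n" for i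
  proof -
    let ?g = "\<lambda>j. (-1) ^ i * f x (ys ! i) * ((-1) ^ j * f x (delete_nth i ys ! j) * pfaffian f (delete_nth j (delete_nth i ys)))"
    have "(-1) ^ i * f x (ys ! i) * pfaffian f (x # delete_nth i ys) = (\<Sum>j<n-1. ?g j)"
      using i by (simp add: sum_distrib_left n_def min_def pfaffian.simps(2))
    also have "\<dots> = (\<Sum>j<i. ?g j) + (\<Sum>j=i..<n-1. ?g j)"
      using i sum.atLeastLessThan_concat[of 0 i "n - 1" ?g] by (simp add: lessThan_atLeast0)
    also have "(\<Sum>j<i. ?g j) = (\<Sum>j<i. T j i)"
      using i by (intro sum.cong refl) (simp add: T_def nth_delete_nth n_def power_add ac_simps)
    also have "\<dots> = (\<Sum>j<n. if j < i then T j i else 0)"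
      using i by (intro sum.mono_neutral_cong_left) auto
    also have "(\<Sum>j=i..<n-1. ?g j) = (\<Sum>j=i..<n-1. - T i (Suc j))"
    proof (intro sum.cong refl)
      fix j assume j: "j \<in> {i..<n-1}"
      then have "delete_nth j (delete_nth i ys) = delete_nth i (delete_nth (Suc j) ys)"
        using delete_nth_delete_nth[of i "Suc j" ys] by (auto simp: n_def)
      moreover have "delete_nth i ys ! j = ys ! Suc j"
        using i j nth_delete_nth[of i ys j] by (simp add: n_def)
      moreover have "(-1) ^ (i + Suc j) = - ((-1) ^ i * (-1) ^ j :: 'k)"
        by (simp add: power_add)
      ultimately show "?g j = - T i (Suc j)"
        unfolding T_def by (simp only: mult_minus_left minus_minus mult.assoc mult.left_commute)
    qed
    also have "\<dots> = (\<Sum>j=Suc i..<Suc (n-1). - T i j)"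
      by (rule sum.shift_bounds_Suc_ivl[symmetric])
    also have "\<dots> = - (\<Sum>j<n. if i < j then T i j else 0)"
      unfolding sum_negf using i by (intro arg_cong[of _ _ uminus] sum.mono_neutral_cong_left) auto
    finally show ?thesis by simp
  qed
  have "pfaffian f (x # x # ys) = - (\<Sum>i<n. (-1) ^ i * f x (ys ! i) * pfaffian f (x # delete_nth i ys))"
    using pfaffian_Cons_append_Cons[of f x "[]" x ys] assms by (simp add: n_def sum_negf)
  also have "(\<Sum>i<n. (-1) ^ i * f x (ys ! i) * pfaffian f (x # delete_nth i ys))
      = (\<Sum>i<n. (\<Sum>j<n. if j < i then T j i else 0) - (\<Sum>j<n. if i < j then T i j else 0))"
    by (intro sum.cong refl inner) simp
  also have "\<dots> = 0"
    unfolding sum_subtractf by (subst sum.swap) (rule diff_self)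
  finally show ?thesis by simp
qed

locale alternating_form = vector_space scale
  for scale :: "'k::field \<Rightarrow> 'v::ab_group_add \<Rightarrow> 'v" (infixr "*s" 75) +
  fixes f :: "'v \<Rightarrow> 'v \<Rightarrow> 'k"
  assumes add_left: "f (u + w) v = f u v + f w v"
    and add_right: "f v (u + w) = f v u + f v w"
    and scale_left: "f (a *s u) v = a * f u v"
    and scale_right: "f v (a *s u) = a * f v u"
    and self: "f u u = 0"
begin

lemma skew: "f u v = - f v u"
proof -
  have "0 = f (u + v) (u + v)" by (simp only: self)
  also have "\<dots> = (f u u + f u v) + (f v u + f v v)" by (simp add: add_left[of u v] add_right ac_simps)
  also have "\<dots> = f u v + f v u" by (simp add: self)
  finally show ?thesis by (metis eq_neg_iff_add_eq_0)
qed

lemma zero_left [simp]: "f 0 v = 0" and zero_right [simp]: "f v 0 = 0"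
  using scale_left[of 0 0 v] scale_right[of v 0 0] by simp_all

lemma pfaffian_linear:
  "pfaffian f (ys @ (a *s u + w) # xs) = a * pfaffian f (ys @ u # xs) + pfaffian f (ys @ w # xs)"
proof (induction ys arbitrary: xs rule: length_induct)
  case (1 ys)
  show ?case
  proof (cases ys)
    case Nil
    then show ?thesis
      by (simp add: pfaffian.simps(2) add_left scale_left sum.distrib sum_distrib_left algebra_simps)
  next
    case (Cons y ys')
    have IH: "pfaffian f (zs @ (a *s u + w) # xs') = a * pfaffian f (zs @ u # xs') + pfaffian f (zs @ w # xs')"
      if "length zs < length ys" for zs xs'
      using 1 that by blast
    have "pfaffian f (delete_nth i ys' @ (a *s u + w) # xs)
        = a * pfaffian f (delete_nth i ys' @ u # xs) + pfaffian f (delete_nth i ys' @ w # xs)" for i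
      using Cons by (intro IH) simp
    moreover have "pfaffian f (ys' @ (a *s u + w) # delete_nth j xs)
        = a * pfaffian f (ys' @ u # delete_nth j xs) + pfaffian f (ys' @ w # delete_nth j xs)" for j
      using Cons by (intro IH) simp
    ultimately show ?thesis
      unfolding Cons append_Cons pfaffian_Cons_append_Cons
      by (simp only: add_right scale_right distrib_left distrib_right sum.distrib sum_distrib_left) (simp add: ac_simps)
  qed
qed

lemma pfaffian_adjacent_same: "pfaffian f (ys @ x # x # xs) = 0"
proof (induction ys arbitrary: xs rule: length_induct)
  case (1 ys)
  show ?case
  proof (cases ys)
    case Nil
    then show ?thesis using pfaffian_Cons_Cons_same[of f x xs] self by simp
  next
    case (Cons y ys')
    have IH: "pfaffian f (zs @ x # x # xs') = 0" if "length zs < length ys" for zs xs'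
      using 1 that by blast
    have a: "pfaffian f (delete_nth i ys' @ x # x # xs) = 0" for i
      using Cons by (intro IH) simp
    have b: "pfaffian f (ys' @ x # x # delete_nth j xs) = 0" for j
      using Cons by (intro IH) simp
    let ?g = "\<lambda>j. (-1) ^ Suc (length ys' + j) * f y ((x # xs) ! j) * pfaffian f (ys' @ x # delete_nth j (x # xs))"
    have "(\<Sum>j<length (x # xs). ?g j) = ?g 0 + (\<Sum>j<length xs. ?g (Suc j))"
      unfolding length_Cons by (rule sum.lessThan_Suc_shift)
    also have "(\<Sum>j<length xs. ?g (Suc j)) = 0"
      unfolding take_Suc_Cons drop_Suc_Cons append_Cons b by simp
    finally have "(\<Sum>j<length (x # xs). ?g j) = - ((-1) ^ length ys' * f y x * pfaffian f (ys' @ x # xs))"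
      by simp
    then show ?thesis
      unfolding Cons append_Cons pfaffian_Cons_append_Cons a by simp
  qed
qed

lemma pfaffian_swap: "pfaffian f (ys @ u # v # xs) = - pfaffian f (ys @ v # u # xs)"
proof -
  have lin: "pfaffian f (as @ (b + c) # bs) = pfaffian f (as @ b # bs) + pfaffian f (as @ c # bs)" for as b c bs
    using pfaffian_linear[of as 1 b c bs] by simp
  have "0 = pfaffian f (ys @ (u + v) # (u + v) # xs)" by (simp only: pfaffian_adjacent_same)
  also have "\<dots> = pfaffian f (ys @ u # (u + v) # xs) + pfaffian f (ys @ v # (u + v) # xs)"
    by (rule lin)
  also have "\<dots> = pfaffian f (ys @ u # v # xs) + pfaffian f (ys @ v # u # xs)"
    using lin[of "ys @ [u]" u v xs] lin[of "ys @ [v]" u v xs]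
    by (simp add: pfaffian_adjacent_same)
  finally show ?thesis by (metis eq_neg_iff_add_eq_0)
qed

lemma pfaffian_move: "pfaffian f (ys @ as @ u # xs) = pfaffian f (ys @ u # as @ xs) \<or> pfaffian f (ys @ as @ u # xs) = - pfaffian f (ys @ u # as @ xs)"
proof (induction as arbitrary: ys)
  case (Cons a as)
  have "pfaffian f (ys @ a # u # as @ xs) = - pfaffian f (ys @ u # a # as @ xs)"
    by (rule pfaffian_swap)
  with Cons[of "ys @ [a]"] show ?case by auto
qed simp

lemma pfaffian_perm:
  "mset xs = mset ys \<Longrightarrow> pfaffian f (zs @ xs) = pfaffian f (zs @ ys) \<or> pfaffian f (zs @ xs) = - pfaffian f (zs @ ys)"
proof (induction xs arbitrary: ys zs)
  case (Cons x xs)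
  then have "x \<in> set ys" by (metis list.set_intros(1) mset_eq_setD)
  then obtain as bs where ys: "ys = as @ x # bs" by (meson split_list)
  with Cons.prems have "mset xs = mset (as @ bs)" by simp
  from Cons.IH[OF this, of "zs @ [x]"] pfaffian_move[of zs as x bs] show ?case
    by (auto simp: ys)
qed simp

lemma pfaffian_not_distinct:
  assumes "\<not> distinct xs"
  shows "pfaffian f xs = 0"
proof -
  from not_distinct_decomp[OF assms] obtain as bs cs x where xs: "xs = as @ [x] @ bs @ [x] @ cs" by blast
  then have "mset xs = mset (x # x # as @ bs @ cs)" by simp
  from pfaffian_perm[OF this, of "[]"] pfaffian_adjacent_same[of "[]" x "as @ bs @ cs"] show ?thesis
    by auto
qed

lemma pfaffian_subspace: "subspace {u. pfaffian f (ys @ u # xs) = 0}"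
proof (rule subspaceI)
  have lin: "pfaffian f (ys @ (a *s u + w) # xs) = a * pfaffian f (ys @ u # xs) + pfaffian f (ys @ w # xs)" for a u w
    by (rule pfaffian_linear)
  show zero: "0 \<in> {u. pfaffian f (ys @ u # xs) = 0}"
    using lin[of "-1" 0 0] by simp
  show "u + w \<in> {u. pfaffian f (ys @ u # xs) = 0}"
    if "u \<in> {u. pfaffian f (ys @ u # xs) = 0}" "w \<in> {u. pfaffian f (ys @ u # xs) = 0}" for u w
    using lin[of 1 u w] that by simp
  show "a *s u \<in> {u. pfaffian f (ys @ u # xs) = 0}" if "u \<in> {u. pfaffian f (ys @ u # xs) = 0}" for a u
    using lin[of a u 0] that zero by simp
qed

text \<open>
  Expand the entries of \<open>vs\<close> in terms of \<open>es\<close>, one position after the other. This leads to lists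
  with entries in \<open>es\<close>, which either have a repeated entry or are permutations of \<open>es\<close>.
\<close>

lemma pfaffian_eq_0_if_pfaffian_spanning_eq_0:
  assumes "span (set es) = UNIV" "pfaffian f es = 0" "length vs = length es"
  shows "pfaffian f vs = 0"
proof -
  have "pfaffian f (ys @ xs) = 0" if "set ys \<subseteq> set es" "length ys + length xs = length es" for ys xs
    using that
  proof (induction xs arbitrary: ys)
    case Nil
    show ?case
    proof (cases "distinct ys")
      case True
      have "card (set ys) = length es" using True Nil by (simp add: distinct_card)
      moreover have "card (set es) \<le> length es" by (rule card_length)
      moreover have "card (set ys) \<le> card (set es)"
        using Nil.prems(1) by (intro card_mono) auto
      ultimately have card: "card (set ys) = card (set es)" "card (set es) = length es" by auto
      then have "set ys = set es"
        using Nil.prems(1) by (intro card_subset_eq) auto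
      then have "mset ys = mset es"
        using True using card by (simp add: set_eq_iff_mset_eq_distinct card_distinct)
      from pfaffian_perm[OF this, of "[]"] assms(2) show ?thesis by auto
    qed (simp add: pfaffian_not_distinct)
  next
    case (Cons x xs)
    have "set es \<subseteq> {u. pfaffian f (ys @ u # xs) = 0}"
    proof
      fix e assume "e \<in> set es"
      with Cons.prems Cons.IH[of "ys @ [e]"] show "e \<in> {u. pfaffian f (ys @ u # xs) = 0}" by simp
    qed
    then have "span (set es) \<subseteq> {u. pfaffian f (ys @ u # xs) = 0}"
      by (rule span_minimal) (rule pfaffian_subspace)
    with assms(1) show ?case by blast
  qed
  from this[of "[]" vs] assms(3) show ?thesis by simp
qed

text \<open>
  A nonzero vector \<open>u\<close> of the radical involves some entry \<open>e\<close> of \<open>es\<close>. Putting \<open>u\<close> in the place of \<open>e\<close>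
  multiplies the Pfaffian by the coefficient of \<open>e\<close> and at the same time makes it vanish.
\<close>

lemma pfaffian_eq_0_if_degenerate:
  assumes "span (set es) = UNIV" "u \<noteq> 0" "\<And>v. f u v = 0"
  shows "pfaffian f es = 0"
proof -
  obtain c where c: "u = (\<Sum>e\<in>set es. c e *s e)"
  proof -
    have "u \<in> span (set es)" using assms(1) by simp
    then show thesis using that unfolding span_finite[OF finite_set] by blast
  qed
  have "\<exists>e\<in>set es. c e \<noteq> 0"
  proof (rule ccontr)
    assume "\<not> (\<exists>e\<in>set es. c e \<noteq> 0)"
    then have "(\<Sum>e\<in>set es. c e *s e) = 0" by (intro sum.neutral) simp
    with c assms(2) show False by simp
  qed
  then obtain e where e: "e \<in> set es" "c e \<noteq> 0" by blast
  then obtain as bs where es: "es = as @ e # bs" by (meson split_list)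
  define y where "y = (\<Sum>e'\<in>set es - {e}. c e' *s e')"
  have u: "u = c e *s e + y"
    unfolding y_def c by (rule sum.remove) (use e in simp_all)
  have "set as \<union> set bs \<subseteq> {w. pfaffian f (as @ w # bs) = 0}"
    by (auto intro: pfaffian_not_distinct)
  then have "span (set as \<union> set bs) \<subseteq> {w. pfaffian f (as @ w # bs) = 0}"
    by (rule span_minimal) (rule pfaffian_subspace)
  moreover have "y \<in> span (set as \<union> set bs)"
    unfolding y_def by (intro span_sum span_scale span_base) (auto simp: es)
  ultimately have "pfaffian f (as @ y # bs) = 0" by auto
  moreover have "f v u = 0" for v using skew[of v u] assms(3) by simp
  then have "pfaffian f (as @ u # bs) = 0"
    using assms(3) by (intro pfaffian_eq_0_if_radical_mem[of u]) simp_all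
  ultimately have "c e * pfaffian f es = 0"
    using pfaffian_linear[of as "c e" e y bs] unfolding u[symmetric] es by simp
  with e show ?thesis by simp
qed

end

text \<open>
  Splitting off hyperbolic planes \<open>\<langle>a, b\<rangle>\<close> with \<open>f a b = 1\<close> until the radical is left. The planes
  together give a list of Pfaffian one, and its even length accounts for the codimension of the
  radical. Counting elements replaces arguments on dimensions.
\<close>

lemma exists_hyperbolic_list:
  fixes scale :: "'k::{field,finite} \<Rightarrow> 'v::ab_group_add \<Rightarrow> 'v"
  assumes "alternating_form scale f" "finite W" "module.subspace scale W"
  shows "\<exists>r ws. length ws = 2 * r \<and> set ws \<subseteq> W \<and> pfaffian f ws = 1 \<and>
    card W = card (UNIV :: 'k set) ^ (2 * r) * card {u \<in> W. \<forall>w\<in>W. f u w = 0}"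
proof -
  interpret alternating_form scale f by fact
  show ?thesis
    using assms(2,3)
  proof (induction "card W" arbitrary: W rule: less_induct)
    case less
    show ?case
    proof (cases "\<forall>u\<in>W. \<forall>w\<in>W. f u w = 0")
      case True
      then have "{u \<in> W. \<forall>w\<in>W. f u w = 0} = W" by auto
      then show ?thesis by (intro exI[of _ 0] exI[of _ "[]"]) simp
    next
      case False
      then obtain a b' where ab': "a \<in> W" "b' \<in> W" "f a b' \<noteq> 0" by auto
      define b where "b = scale (1 / f a b') b'"
      have b: "b \<in> W" "f a b = 1" "f b a = - 1"
        using ab' less.prems(2) skew[of b a] by (auto simp: b_def scale_right subspace_scale)
      define W' where "W' = {w \<in> W. f a w = 0 \<and> f b w = 0}"
      have sub: "subspace W'"
        using less.prems(2) unfolding W'_def subspace_def by (auto simp: add_right scale_right)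
      have "W' \<subset> W" using b ab' by (auto simp: W'_def)
      then have "card W' < card W" using less.prems(1) by (rule psubset_card_mono[rotated])
      moreover have fin: "finite W'" using less.prems(1) by (simp add: W'_def)
      ultimately obtain r ws where IH: "length ws = 2 * r" "set ws \<subseteq> W'" "pfaffian f ws = 1"
        "card W' = card (UNIV :: 'k set) ^ (2 * r) * card {u \<in> W'. \<forall>w\<in>W'. f u w = 0}"
        using less.hyps sub by blast
      have pfaffian_ws: "pfaffian f (a # b # ws) = 1"
      proof -
        have "(\<Sum>i<length ws. (-1) ^ Suc i * f a (ws ! i) * pfaffian f (b # delete_nth i ws)) = 0"
        proof (intro sum.neutral ballI)
          fix i assume "i \<in> {..<length ws}"
          then have "ws ! i \<in> W'" using IH(2) by auto
          then have "f a (ws ! i) = 0" by (simp add: W'_def)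
          then show "(-1) ^ Suc i * f a (ws ! i) * pfaffian f (b # delete_nth i ws) = 0" by simp
        qed
        then show ?thesis
          using pfaffian_Cons_append_Cons[of f a "[]" b ws] b IH(3) by simp
      qed
      have bij: "bij_betw (\<lambda>(s, t, w). scale s a + scale t b + w) (UNIV \<times> UNIV \<times> W') W"
      proof (rule bij_betw_byWitness[where f' = "\<lambda>w. (- f b w, f a w, w - (scale (- f b w) a + scale (f a w) b))"])
        show "\<forall>x\<in>UNIV \<times> UNIV \<times> W'. (\<lambda>w. (- f b w, f a w, w - (scale (- f b w) a + scale (f a w) b)))
            ((\<lambda>(s, t, w). scale s a + scale t b + w) x) = x"
          using b by (auto simp: W'_def add_right scale_right self)
        show "\<forall>w\<in>W. (\<lambda>(s, t, w). scale s a + scale t b + w)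
            (- f b w, f a w, w - (scale (- f b w) a + scale (f a w) b)) = w"
          by simp
        show "(\<lambda>(s, t, w). scale s a + scale t b + w) ` (UNIV \<times> UNIV \<times> W') \<subseteq> W"
          using less.prems(2) ab'(1) b(1) by (auto simp: W'_def intro!: subspace_add subspace_scale)
        have diff_right: "f u (v - w) = f u v - f u w" for u v w
          using add_right[of u "v - w" w] by simp
        show "(\<lambda>w. (- f b w, f a w, w - (scale (- f b w) a + scale (f a w) b))) ` W \<subseteq> UNIV \<times> UNIV \<times> W'"
          using less.prems(2) ab'(1) b
          by (auto simp: W'_def diff_right add_right scale_right self intro!: subspace_diff subspace_add subspace_scale)
      qed
      have decomp: "\<exists>s t w'. w' \<in> W' \<and> w = scale s a + scale t b + w'" if "w \<in> W" for w
      proof -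
        from that bij have "w \<in> (\<lambda>(s, t, w). scale s a + scale t b + w) ` (UNIV \<times> UNIV \<times> W')"
          by (simp add: bij_betw_def)
        then show ?thesis by auto
      qed
      have rad: "{u \<in> W'. \<forall>w\<in>W'. f u w = 0} = {u \<in> W. \<forall>w\<in>W. f u w = 0}"
      proof (intro equalityI subsetI CollectI conjI)
        fix u assume u: "u \<in> {u \<in> W'. \<forall>w\<in>W'. f u w = 0}"
        then show "u \<in> W" by (simp add: W'_def)
        show "\<forall>w\<in>W. f u w = 0"
        proof
          fix w assume "w \<in> W"
          then obtain s t w' where w: "w' \<in> W'" "w = scale s a + scale t b + w'"
            using decomp by blast
          have "f u a = 0" "f u b = 0" using u skew[of u a] skew[of u b] by (auto simp: W'_def)
          with u w show "f u w = 0" by (simp add: add_right scale_right)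
        qed
      next
        fix u assume u: "u \<in> {u \<in> W. \<forall>w\<in>W. f u w = 0}"
        then have "f a u = 0" "f b u = 0"
          using skew[of a u] skew[of b u] ab'(1) b(1) by auto
        with u show "u \<in> W'" by (simp add: W'_def)
        show "\<forall>w\<in>W'. f u w = 0" using u by (simp add: W'_def)
      qed
      have "card W = card (UNIV :: 'k set) * (card (UNIV :: 'k set) * card W')"
        using bij_betw_same_card[OF bij] by (simp add: card_cartesian_product)
      also have "\<dots> = card (UNIV :: 'k set) ^ (2 * Suc r) * card {u \<in> W. \<forall>w\<in>W. f u w = 0}"
        by (simp add: IH(4) rad)
      finally have "card W = card (UNIV :: 'k set) ^ (2 * Suc r) * card {u \<in> W. \<forall>w\<in>W. f u w = 0}" .
      moreover have "set (a # b # ws) \<subseteq> W" using ab'(1) b(1) IH(2) by (auto simp: W'_def)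
      moreover have "length (a # b # ws) = 2 * Suc r" using IH(1) by simp
      ultimately show ?thesis using pfaffian_ws by blast
    qed
  qed
qed

section \<open>Counting forms and radicals\<close>

context vector_space
begin

lemma card_span_independent:
  assumes "finite (UNIV :: 'a set)" "finite B" "independent B"
  shows "finite (span B) \<and> card (span B) = card (UNIV :: 'a set) ^ card B"
  using assms(2,3)
proof (induction B rule: finite_induct)
  case (insert b B)
  then have B: "independent B" "b \<notin> span B"
    by (auto simp: independent_insert)
  have "bij_betw (\<lambda>(c, y). scale c b + y) (UNIV \<times> span B) (span (insert b B))"
    unfolding bij_betw_def
  proof
    show "inj_on (\<lambda>(c, y). scale c b + y) (UNIV \<times> span B)"
    proof (rule inj_onI, clarsimp)
      fix c y c' y'
      assume *: "y \<in> span B" "y' \<in> span B" "scale c b + y = scale c' b + y'"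
      then have eq: "scale (c - c') b = y' - y" by (simp add: scale_left_diff_distrib algebra_simps)
      have "c = c'"
      proof (rule ccontr)
        assume "c \<noteq> c'"
        then have "b = scale (1 / (c - c')) (scale (c - c') b)" by simp
        also have "\<dots> \<in> span B" unfolding eq using * by (intro span_scale span_diff)
        finally show False using B(2) by simp
      qed
      with * show "c = c' \<and> y = y'" by simp
    qed
    show "(\<lambda>(c, y). scale c b + y) ` (UNIV \<times> span B) = span (insert b B)"
    proof safe
      fix c y assume "y \<in> span B"
      then show "scale c b + y \<in> span (insert b B)"
        using span_mono[OF subset_insertI, of B b] span_base[of b "insert b B"]
        by (intro span_add span_scale) auto
    next
      fix x assume "x \<in> span (insert b B)"
      then obtain c where "x - scale c b \<in> span B" using span_breakdown_eq by blast
      then have "(c, x - scale c b) \<in> UNIV \<times> span B" by simp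
      then show "x \<in> (\<lambda>(c, y). scale c b + y) ` (UNIV \<times> span B)"
        by (intro image_eqI[of _ _ "(c, x - scale c b)"]) simp_all
    qed
  qed
  moreover have "finite ((UNIV :: 'a set) \<times> span B)" "card ((UNIV :: 'a set) \<times> span B) = card (UNIV :: 'a set) ^ card (insert b B)"
    using insert B assms(1) by (simp_all add: card_cartesian_product)
  ultimately show ?case
    by (metis bij_betw_finite bij_betw_same_card)
qed simp

lemma card_subspace:
  assumes "finite (UNIV :: 'a set)" "finite S" "subspace S"
  shows "card S = card (UNIV :: 'a set) ^ dim S"
proof -
  obtain B where B: "B \<subseteq> S" "independent B" "S \<subseteq> span B" "card B = dim S"
    using basis_exists by blast
  then have "span B = S" using span_minimal[OF B(1) assms(3)] by auto
  moreover have "finite B" using B(1) assms(2) finite_subset by blast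
  ultimately show ?thesis using card_span_independent[OF assms(1)] B by metis
qed

end

lemma alternating_form_if_Alt:
  assumes "vector_space scale" "f \<in> Alt scale"
  shows "alternating_form scale f"
proof -
  interpret vector_space scale by fact
  have lin: "g (x + y) = g x + g y \<and> g (scale c x) = c * g x" if "Vector_Spaces.linear scale (*) g" for g x y c
    using that by (auto simp: Vector_Spaces.linear_iff_module_hom module_hom_iff)
  have f: "Vector_Spaces.linear scale (*) (\<lambda>v. f u v)" "Vector_Spaces.linear scale (*) (\<lambda>u. f u v)" for u v
    using assms(2) by (auto simp: Alt_def bilinear_form_def)
  show ?thesis
    by unfold_locales (use lin[OF f(1)] lin[OF f(2)] assms(2) in \<open>auto simp: Alt_def\<close>)
qed

text \<open>
  The degree of the Pfaffian in the form is half the length of the list, because each expansion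
  step multiplies by one value of the form and removes two vectors.
\<close>

lemma lifts_pfaffian:
  fixes \<phi> :: "'a::comm_semiring_1 \<Rightarrow> 'v \<Rightarrow> 'v \<Rightarrow> 'k::comm_ring_1"
  assumes "nspan \<epsilon> = UNIV" "\<And>u v. lifts \<epsilon> 1 (\<lambda>x. \<phi> x u v)"
  shows "length vs = 2 * m \<Longrightarrow> lifts \<epsilon> m (\<lambda>x. pfaffian (\<phi> x) vs)"
proof (induction m arbitrary: vs)
  case 0
  then show ?case by (simp add: lifts_const[OF assms(1)])
next
  case (Suc m)
  then obtain v ws where vs: "vs = v # ws" by (cases vs) auto
  have "lifts \<epsilon> (0 + 1 + m) (\<lambda>x. (-1) ^ i * \<phi> x v (ws ! i) * pfaffian (\<phi> x) (delete_nth i ws))"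
    if "i < length ws" for i
    using Suc.prems that vs
    by (intro lifts_mult[OF assms(1)] lifts_const[OF assms(1)] assms(2) Suc.IH) auto
  then show ?case
    unfolding vs pfaffian.simps(2) by (intro lifts_sum[OF assms(1)]) simp
qed

lemma card_pfaffian_zeros_dvd:
  fixes M :: "('v \<Rightarrow> 'v \<Rightarrow> 'k::comm_ring_1) set"
  assumes "prime p" "of_nat p = (0::'k)" "nindep \<epsilon>" "nspan \<epsilon> = (UNIV :: 'k set)"
    and "finite M" "0 \<in> M" "\<And>f g. f \<in> M \<Longrightarrow> g \<in> M \<Longrightarrow> f + g \<in> M"
    and "length es = 2 * m" "m \<ge> 1" "card M = p ^ N" "m * (length \<epsilon> + b) < N + m"
  shows "p ^ b dvd card {f \<in> M. pfaffian f es = 0}"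
proof (rule card_zeros_dvd[OF assms(1,2) _ assms(3-7) _ assms(9-11)])
  show "of_nat p = (0 :: 'v \<Rightarrow> 'v \<Rightarrow> 'k)"
    using assms(2) by (simp add: fun_eq_iff)
  fix B :: "('v \<Rightarrow> 'v \<Rightarrow> 'k) set"
  have apply_sum: "(\<Sum>g\<in>B. of_nat (x g) * g) u v = (\<Sum>g\<in>B. of_nat (x g) * g u v)"
    for x :: "('v \<Rightarrow> 'v \<Rightarrow> 'k) \<Rightarrow> nat" and u v
    by (induction B rule: infinite_finite_induct) auto
  show "lifts \<epsilon> m (\<lambda>x :: ('v \<Rightarrow> 'v \<Rightarrow> 'k) \<Rightarrow> nat. pfaffian (\<Sum>g\<in>B. of_nat (x g) * g) es)"
    by (rule lifts_pfaffian[OF assms(4) _ assms(8)]) (simp only: apply_sum lifts_additive[OF assms(4)])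
qed

text \<open>
  The hyperbolic list has the length of a basis exactly if the radical is trivial, and then its
  nonzero Pfaffian forces that of \<open>es\<close> to be nonzero. The exponent \<open>2 * r\<close> records that the rank of
  an alternating form is even.
\<close>

lemma pfaffian_eq_0_iff:
  fixes scale :: "'k::{field,finite} \<Rightarrow> 'v::ab_group_add \<Rightarrow> 'v"
  assumes "alternating_form scale f" "finite (UNIV :: 'v set)"
    and "module.span scale (set es) = UNIV" "length es = 2 * m"
    and "card (UNIV :: 'v set) = card (UNIV :: 'k set) ^ (2 * m)"
  shows "(pfaffian f es \<noteq> 0 \<longrightarrow> card (form_rad f) = 1) \<and>
    (pfaffian f es = 0 \<longrightarrow> (\<exists>r\<ge>1. card (form_rad f) = card (UNIV :: 'k set) ^ (2 * r)))"
proof -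
  interpret alternating_form scale f by fact
  let ?q = "card (UNIV :: 'k set)"
  have "card {0, 1 :: 'k} \<le> ?q" by (intro card_mono) auto
  then have q: "?q > 1" by simp
  obtain r ws where ws: "length ws = 2 * r" "pfaffian f ws = 1"
    and card: "card (UNIV :: 'v set) = ?q ^ (2 * r) * card {u \<in> UNIV. \<forall>w\<in>UNIV. f u w = 0}"
    using exists_hyperbolic_list[OF assms(1,2) subspace_UNIV] by blast
  have rad: "{u \<in> UNIV. \<forall>w\<in>UNIV. f u w = 0} = form_rad f" by (simp add: form_rad_def)
  have fin: "finite (form_rad f)" using assms(2) by (rule finite_subset[OF subset_UNIV])
  have "0 \<in> form_rad f" by (simp add: form_rad_def)
  then have pos: "card (form_rad f) > 0" using fin card_gt_0_iff by blast
  have eq: "?q ^ (2 * m) = ?q ^ (2 * r) * card (form_rad f)"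
    using card unfolding rad assms(5) .
  have "?q ^ (2 * r) \<le> ?q ^ (2 * m)" unfolding eq using pos by simp
  then have r: "r \<le> m" using power_le_imp_le_exp[OF q] by fastforce
  then have "2 * m = 2 * r + 2 * (m - r)" by simp
  then have "?q ^ (2 * m) = ?q ^ (2 * r) * ?q ^ (2 * (m - r))"
    by (metis power_add)
  with eq have "?q ^ (2 * r) * card (form_rad f) = ?q ^ (2 * r) * ?q ^ (2 * (m - r))"
    by (rule trans[OF sym])
  moreover have "?q ^ (2 * r) \<noteq> 0" using q by (intro power_not_zero) linarith
  ultimately have card_rad: "card (form_rad f) = ?q ^ (2 * (m - r))"
    by (metis mult_left_cancel)
  show ?thesis
  proof (intro conjI impI)
    assume "pfaffian f es \<noteq> 0"
    then have "form_rad f = {0}"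
      using pfaffian_eq_0_if_degenerate[OF assms(3)] \<open>0 \<in> form_rad f\<close> by (auto simp: form_rad_def)
    then show "card (form_rad f) = 1" by simp
  next
    assume pfaffian: "pfaffian f es = 0"
    have "r \<noteq> m"
    proof
      assume "r = m"
      with pfaffian_eq_0_if_pfaffian_spanning_eq_0[OF assms(3) pfaffian, of ws] ws assms(4) show False by simp
    qed
    with r card_rad show "\<exists>r\<ge>1. card (form_rad f) = ?q ^ (2 * r)"
      by (intro exI[of _ "m - r"]) auto
  qed
qed

lemma card_le_card_image_times_fibre:
  assumes "finite A" "\<And>x. x \<in> A \<Longrightarrow> card {y \<in> A. h y = h x} \<le> c"
  shows "card A \<le> card (h ` A) * c"
proof -
  have "card A = card (\<Union>t\<in>h ` A. {y \<in> A. h y = t})" by (rule arg_cong[of _ _ card]) auto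
  also have "\<dots> \<le> (\<Sum>t\<in>h ` A. card {y \<in> A. h y = t})"
    using assms(1) by (intro card_UN_le) simp
  also have "\<dots> \<le> (\<Sum>t\<in>h ` A. c)" using assms(2) by (intro sum_mono) auto
  finally show ?thesis by simp
qed

text \<open>
  The linear map sending \<open>f\<close> to \<open>f u\<close> has the forms with \<open>u\<close> in the radical as kernel, and as
  \<open>f u u = 0\<close>, the functional \<open>f u\<close> is determined by its values at the other elements of a basis
  that contains \<open>u\<close>.
\<close>

lemma card_forms_le:
  fixes scale :: "'k::{field,finite} \<Rightarrow> 'v::ab_group_add \<Rightarrow> 'v"
  assumes "vector_space scale" "finite (UNIV :: 'v set)"
    and "M \<subseteq> Alt scale" "forms.subspace M" "u \<noteq> 0"
  shows "card M \<le> card (UNIV :: 'k set) ^ (vector_space.dim scale (UNIV :: 'v set) - 1)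
    * card {f \<in> M. u \<in> form_rad f}"
proof -
  interpret vector_space scale by fact
  have finM: "finite M"
    by (rule finite_subset[OF subset_UNIV]) (use assms(2) in \<open>simp add: finite_UNIV_fun\<close>)
  have "independent {u}" using assms(5) by (simp add: dependent_single)
  then obtain B where B: "{u} \<subseteq> B" "independent B" "UNIV \<subseteq> span B"
    using maximal_independent_subset_extend[of "{u}" UNIV] by auto
  have finB: "finite B" using assms(2) by (rule finite_subset[OF subset_UNIV])
  have cardB: "card B = dim (UNIV :: 'v set)"
    using B by (intro basis_card_eq_dim) auto
  define h where "h f = restrict (f u) (B - {u})" for f :: "'v \<Rightarrow> 'v \<Rightarrow> 'k"
  have "card {g \<in> M. h g = h f} \<le> card {f \<in> M. u \<in> form_rad f}" if f: "f \<in> M" for f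
  proof (rule card_inj_on_le[of "\<lambda>g. g - f"])
    show "inj_on (\<lambda>g. g - f) {g \<in> M. h g = h f}" by (auto simp: inj_on_def)
    show "finite {f \<in> M. u \<in> form_rad f}" using finM by simp
    show "(\<lambda>g. g - f) ` {g \<in> M. h g = h f} \<subseteq> {f \<in> M. u \<in> form_rad f}"
    proof clarify
      fix g assume g: "g \<in> M" "h g = h f"
      then have "g - f \<in> M" using assms(4) f by (intro forms.subspace_diff)
      moreover have "u \<in> form_rad (g - f)"
      proof -
        interpret alternating_form scale "g - f"
          using \<open>g - f \<in> M\<close> assms(1,3) by (intro alternating_form_if_Alt) auto
        have "(g - f) u b = 0" if "b \<in> B" for b
        proof (cases "b = u")
          case False
          with that have "h g b = g u b" "h f b = f u b" by (simp_all add: h_def)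
          with g(2) show ?thesis by simp
        qed (simp only: self)
        then have "B \<subseteq> {v. (g - f) u v = 0}" by blast
        moreover have "subspace {v. (g - f) u v = 0}"
          by (rule subspaceI) (simp_all only: mem_Collect_eq zero_right add_right scale_right, simp_all)
        ultimately have "span B \<subseteq> {v. (g - f) u v = 0}" by (rule span_minimal)
        with B(3) show ?thesis by (auto simp: form_rad_def)
      qed
      ultimately show "g - f \<in> M \<and> u \<in> form_rad (g - f)" by simp
    qed
  qed
  then have "card M \<le> card (h ` M) * card {f \<in> M. u \<in> form_rad f}"
    using finM by (intro card_le_card_image_times_fibre)
  moreover have "card (h ` M) \<le> card (UNIV :: 'k set) ^ (dim (UNIV :: 'v set) - 1)"
  proof -
    have "h ` M \<subseteq> PiE (B - {u}) (\<lambda>_. UNIV)" by (simp add: image_subset_iff h_def restrict_PiE_iff)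
    then have "card (h ` M) \<le> card (PiE (B - {u}) (\<lambda>_. UNIV :: 'k set))"
      using finB by (intro card_mono finite_PiE) auto
    also have "\<dots> = card (UNIV :: 'k set) ^ (dim (UNIV :: 'v set) - 1)"
      using finB B(1) cardB by (simp add: card_PiE)
    finally show ?thesis .
  qed
  ultimately show ?thesis by (meson mult_le_mono1 order_trans)
qed

theorem theorem7:
  fixes scale :: "'k::{field,finite} \<Rightarrow> 'v::ab_group_add \<Rightarrow> 'v"
    and M :: "('v \<Rightarrow> 'v \<Rightarrow> 'k) set"
    and n m :: nat
  assumes "vector_space scale"
    and "n = 2 * m" and "n > 2"
    and "vector_space.dim scale (UNIV :: 'v set) = n"
    and "M \<subseteq> Alt scale" and "forms.subspace M"
    and "\<forall>f\<in>M. f \<noteq> 0 \<longrightarrow> form_rank scale f \<ge> n - 2"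
  shows "forms.dim M \<le> 3 * m"
proof (rule ccontr)
  assume "\<not> forms.dim M \<le> 3 * m"
  then have dimM: "forms.dim M \<ge> 3 * m + 1" by simp
  interpret V: vector_space scale by fact
  define q where "q = card (UNIV :: 'k set)"
  have "card {0, 1 :: 'k} \<le> q" unfolding q_def by (intro card_mono) auto
  then have q: "q > 1" by simp
  have m: "m \<ge> 2" using assms(2,3) by simp

  obtain B where B: "V.independent B" "V.span B = (UNIV :: 'v set)" "card B = n"
    using V.basis_exists[of UNIV] assms(4) by (metis UNIV_I subsetI subset_antisym)
  have finB: "finite B" using B(3) assms(3) card.infinite by force
  have cardV: "card (UNIV :: 'v set) = q ^ n" and finV: "finite (UNIV :: 'v set)"
    using V.card_span_independent[OF _ finB B(1)] B by (simp_all add: q_def)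
  obtain es where es: "set es = B" "distinct es" using finB finite_distinct_list by blast
  have len_es: "length es = 2 * m" using es B(3) distinct_card assms(2) by metis
  have finM: "finite M"
    by (rule finite_subset[OF subset_UNIV]) (use finV in \<open>simp add: finite_UNIV_fun\<close>)
  have cardM: "card M = q ^ forms.dim M"
    unfolding q_def using finM assms(6) by (intro forms.card_subspace) auto
  have alt: "alternating_form scale f" if "f \<in> M" for f
    using that assms(1,5) alternating_form_if_Alt by blast
  have zero_M: "0 \<in> M" using assms(6) forms.subspace_0 by blast

  define p where "p = CHAR('k)"
  have p: "prime p" "of_nat p = (0::'k)"
    unfolding p_def using finite_imp_CHAR_pos[where ?'a = 'k] by (auto intro: prime_CHAR_semidom)
  obtain \<epsilon> where \<epsilon>: "nindep \<epsilon>" "nspan \<epsilon> = (UNIV :: 'k set)"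
    using exists_nindep_nspan_eq[OF p, of UNIV] by auto
  define k where "k = length \<epsilon>"
  have qk: "q = p ^ k" using card_nspan[OF p \<epsilon>(1)] \<epsilon>(2) by (simp add: q_def k_def)
  then have k: "k \<ge> 1" using q by (cases k) auto

  \<comment> \<open>The Ax-Katz bound for the degenerate forms, one power of \<open>p\<close> above \<open>q\<^sup>2\<close>.\<close>
  define Z where "Z = {f \<in> M. pfaffian f es = 0}"
  have finZ: "finite Z" using finM by (simp add: Z_def)
  have Z_dvd: "p ^ (2 * k + 1) dvd card Z"
    unfolding Z_def
  proof (rule card_pfaffian_zeros_dvd[OF p \<epsilon> finM zero_M _ len_es])
    show "f + g \<in> M" if "f \<in> M" "g \<in> M" for f g
      using that assms(6) forms.subspace_add by blast
    show "card M = p ^ (k * forms.dim M)" using cardM qk by (simp add: power_mult)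
    have "k * (3 * m + 1) \<le> k * forms.dim M" using dimM by (rule mult_le_mono2)
    then have "3 * m * k + k \<le> k * forms.dim M" by (simp add: algebra_simps)
    moreover have "m * (length \<epsilon> + (2 * k + 1)) = 3 * m * k + m" by (simp add: k_def algebra_simps)
    ultimately show "m * (length \<epsilon> + (2 * k + 1)) < k * forms.dim M + m" using k by linarith
  qed (use m in simp)

  have rad: "card (form_rad f) = (if f \<in> Z then q ^ 2 else 1)" if f: "f \<in> M" "f \<noteq> 0" for f
  proof -
    interpret alternating_form scale f using f alt by blast
    have iff: "(pfaffian f es \<noteq> 0 \<longrightarrow> card (form_rad f) = 1) \<and>
        (pfaffian f es = 0 \<longrightarrow> (\<exists>r\<ge>1. card (form_rad f) = q ^ (2 * r)))"
      unfolding q_def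
      using pfaffian_eq_0_iff[OF alt[OF f(1)] finV _ len_es] B(2) es(1) cardV assms(2) by (simp add: q_def)
    have "V.dim (form_rad f) \<le> 2"
      using assms(3,4,7) f by (fastforce simp: form_rank_def)
    moreover have "V.subspace (form_rad f)"
      by (rule V.subspaceI) (simp_all add: form_rad_def add_left scale_left)
    ultimately have "card (form_rad f) \<le> q ^ 2"
      using V.card_subspace[of "form_rad f"] finV finite_subset[OF subset_UNIV finV] q
      by (simp add: q_def power_increasing)
    then have "r \<le> 1" if "card (form_rad f) = q ^ (2 * r)" for r
      using that q by simp
    with iff f(1) show ?thesis
      by (auto simp: Z_def dest!: antisym)
  qed
  have zero_Z: "0 \<in> Z"
  proof -
    have "card (form_rad (0 :: 'v \<Rightarrow> 'v \<Rightarrow> 'k)) = q ^ n"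
      by (simp add: form_rad_def cardV)
    also have "\<dots> \<noteq> 1" using q assms(3) by simp
    finally show ?thesis
      using pfaffian_eq_0_iff[OF alt[OF zero_M] finV _ len_es] B(2) es(1) cardV assms(2) zero_M
      by (auto simp: Z_def q_def)
  qed

  have Mu: "q ^ 3 dvd card {f \<in> M. u \<in> form_rad f}" if u: "u \<noteq> 0" for u
  proof -
    let ?Mu = "{f \<in> M. u \<in> form_rad f}"
    have "forms.subspace ?Mu"
      using assms(6) by (auto simp: forms.subspace_def form_rad_def form_scale_def)
    then have card: "card ?Mu = q ^ forms.dim ?Mu"
      unfolding q_def using finM by (intro forms.card_subspace) auto
    have "q ^ (3 * m + 1) \<le> q ^ forms.dim M" using dimM q by (intro power_increasing) auto
    also have "\<dots> \<le> q ^ (n - 1) * q ^ forms.dim ?Mu"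
      using card_forms_le[OF assms(1) finV assms(5,6) u] assms(4) cardM card by (simp add: q_def)
    finally have "q ^ (3 * m + 1) \<le> q ^ (n - 1 + forms.dim ?Mu)" by (simp add: power_add)
    then have "3 * m + 1 \<le> n - 1 + forms.dim ?Mu" using q power_le_imp_le_exp by blast
    then have "3 \<le> forms.dim ?Mu" using assms(2) m by linarith
    then show ?thesis unfolding card by (rule le_imp_power_dvd)
  qed

  \<comment> \<open>The pairs \<open>(f, u)\<close> with \<open>u\<close> in the radical of \<open>f\<close>, counted first by their vector and below by their form.\<close>
  have "(\<Sum>f\<in>M. card (form_rad f)) = (\<Sum>f\<in>M. \<Sum>u\<in>UNIV. of_bool (u \<in> form_rad f))"
    using finV by (simp add: of_bool_def sum.If_cases)
  also have "\<dots> = (\<Sum>u\<in>UNIV. \<Sum>f\<in>M. of_bool (u \<in> form_rad f))" by (rule sum.swap)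
  also have "\<dots> = (\<Sum>u\<in>UNIV. card {f \<in> M. u \<in> form_rad f})"
    using finM by (simp add: of_bool_def sum.If_cases Int_def)
  also have "\<dots> = card {f \<in> M. 0 \<in> form_rad f} + (\<Sum>u\<in>UNIV - {0}. card {f \<in> M. u \<in> form_rad f})"
    using finV by (intro sum.remove) auto
  also have "{f \<in> M. 0 \<in> form_rad f} = M"
    using alternating_form.zero_left[OF alt] by (auto simp: form_rad_def)
  finally have count: "(\<Sum>f\<in>M. card (form_rad f)) = card M + (\<Sum>u\<in>UNIV - {0}. card {f \<in> M. u \<in> form_rad f})" .

  have "(\<Sum>f\<in>M. card (form_rad f)) = (\<Sum>f\<in>Z. card (form_rad f)) + (\<Sum>f\<in>M - Z. card (form_rad f))"
    using finM by (subst sum.subset_diff[of Z M]) (auto simp: Z_def)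
  also have "(\<Sum>f\<in>Z. card (form_rad f)) = card (form_rad (0 :: 'v \<Rightarrow> 'v \<Rightarrow> 'k)) + (\<Sum>f\<in>Z - {0}. card (form_rad f))"
    using finZ zero_Z by (intro sum.remove)
  also have "card (form_rad (0 :: 'v \<Rightarrow> 'v \<Rightarrow> 'k)) = q ^ n"
    by (simp add: form_rad_def cardV)
  also have "(\<Sum>f\<in>Z - {0}. card (form_rad f)) = (\<Sum>f\<in>Z - {0}. q ^ 2)"
    using rad by (intro sum.cong refl) (auto simp: Z_def)
  also have "\<dots> = (card Z - 1) * q ^ 2" using finZ zero_Z by simp
  also have "(\<Sum>f\<in>M - Z. card (form_rad f)) = (\<Sum>f\<in>M - Z. 1)"
  proof (intro sum.cong refl)
    fix f assume f: "f \<in> M - Z"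
    then have "f \<noteq> 0" using zero_Z by blast
    with f show "card (form_rad f) = 1" using rad[of f] by simp
  qed
  also have "\<dots> = card M - card Z"
    using finZ by (simp add: card_Diff_subset Z_def)
  finally have total: "(\<Sum>f\<in>M. card (form_rad f)) = q ^ n + (card Z - 1) * q ^ 2 + (card M - card Z)" .
  define S where "S = (\<Sum>u\<in>UNIV - {0}. card {f \<in> M. u \<in> form_rad f})"
  have "card Z > 0" using finZ zero_Z card_gt_0_iff by blast
  then obtain z where z: "card Z = Suc z" using gr0_implies_Suc by blast
  have "card Z \<le> card M" using finM by (intro card_mono) (auto simp: Z_def)
  with total count have "q ^ n + z * q ^ 2 = card Z + S"
    unfolding S_def[symmetric] z diff_Suc_1 by linarith
  then have "q ^ n + card Z * q ^ 2 = card Z + S + q ^ 2" by (simp add: z)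
  then have "int (q ^ n + card Z * q ^ 2) = int (card Z + S + q ^ 2)" by (rule arg_cong)
  then have "int q ^ 2 = int q ^ n + int (card Z) * (int q ^ 2 - 1) - int S"
    by (simp add: right_diff_distrib)
  \<comment> \<open>Modulo \<open>q\<^sup>3\<close> the count reads \<open>card Z * (q\<^sup>2 - 1) = q\<^sup>2\<close>; and \<open>p\<^sup>2\<^sup>k\<^sup>+\<^sup>1\<close> divides both \<open>q\<^sup>3\<close> and \<open>card Z\<close>, but not \<open>q\<^sup>2\<close>.\<close>
  moreover have pq: "int p ^ (2 * k + 1) dvd int q ^ 3"
    unfolding qk of_nat_power power_mult[symmetric] using k by (intro le_imp_power_dvd) simp
  have "int p ^ (2 * k + 1) dvd int q ^ n + int (card Z) * (int q ^ 2 - 1) - int S"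
  proof (intro dvd_diff dvd_add)
    have "int q ^ 3 dvd int q ^ n" using assms(2) m by (intro le_imp_power_dvd) simp
    with pq show "int p ^ (2 * k + 1) dvd int q ^ n" by (rule dvd_trans)
    have "int (p ^ (2 * k + 1)) dvd int (card Z)" using Z_dvd of_nat_dvd_iff by blast
    then show "int p ^ (2 * k + 1) dvd int (card Z) * (int q ^ 2 - 1)"
      unfolding of_nat_power by (rule dvd_mult2)
    have "int (q ^ 3) dvd int S"
      unfolding of_nat_dvd_iff S_def using Mu by (intro dvd_sum) auto
    with pq show "int p ^ (2 * k + 1) dvd int S"
      unfolding of_nat_power by (rule dvd_trans)
  qed
  ultimately have "int p ^ (2 * k + 1) dvd int q ^ 2" by simp
  then have "int p ^ (2 * k + 1) dvd int p ^ (2 * k)"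
    unfolding qk of_nat_power power_mult[symmetric] by (simp add: mult.commute)
  then have "2 * k + 1 \<le> 2 * k"
    using prime_gt_1_nat[OF p(1)] by (simp add: dvd_power_iff_le)
  then show False by simp
qed

end
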